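(* Let $k\ge 2$ and let $\mathbb{F}$ be an algebraically closed field whose characteristic is $0$ or at least $k+1$. Let $f\in(\mathbb{F}^d)^{\otimes k}$ be a symmetric tensor. Then the asymptotic subrank and the asymptotic symmetric subrank of $f$ are equal: $$\lim_{n\to\infty} \mathrm{Q}(f^{\otimes n})^{1/n} \;=\; \limsup_{n\to\infty} \mathrm{Q}_{\mathrm{s}}(f^{\otimes n})^{1/n}.$$
   Context: A tensor $f\in(\mathbb{F}^d)^{\otimes k}$ is symmetric if $f_{i_1,\dots,i_k}=f_{i_{\sigma(1)},\dots,i_{\sigma(k)}}$ for all $(i_1,\dots,i_k)\in[d]^k$ and all permutations $\sigma$ of $[k]$. For $r\ge 0$ the unit tensor is $\langle r\rangle=\sum_{i=1}^r e_i^{\otimes k}\in(\mathbb{F}^r)^{\otimes k}$, where $e_1,\dots,e_r$ is the standard basis. The subrank $\mathrm{Q}(f)$ is the largest $r$ such that there are linear maps $A^{(1)},\dots,A^{(k)}:\mathbb{F}^d\to\mathbb{F}^r$ with $\langle r\rangle=(A^{(1)}\otimes\cdots\otimes A^{(k)})f$. The symmetric subrank $\mathrm{Q}_{\mathrm{s}}(f)$ is the largest $r$ such that there is a single linear map $A:\mathbb{F}^d\to\mathbb{F}^r$ with $\langle r\rangle=A^{\otimes k}f$. The power $f^{\otimes n}$ is regarded as a $k$-tensor in $((\mathbb{F}^d)^{\otimes n})^{\otimes k}\cong(\mathbb{F}^{d^n})^{\otimes k}$ (Kronecker power, grouping corresponding legs). *)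

theory Defs
  imports
    "HOL-Analysis.Analysis"
    "HOL-Computational_Algebra.Computational_Algebra"
    "HOL-Combinatorics.Permutations"
begin

text \<open>
  Tensors are given by their coordinates in the standard bases. For an index set \<open>I\<close> a
  multi-index \<open>(i\<^sub>0, \<dots>, i\<^sub>k\<^sub>-\<^sub>1)\<close> is an extensional function from \<open>{..<k}\<close> to \<open>I\<close>, and an element
  of \<open>(F\<^sup>I)\<^sup>\<otimes>\<^sup>k\<close> is an extensional function from multi-indices to the field. Legs are numbered
  from \<open>0\<close>, and \<open>F\<^sup>d\<close> is the case \<open>I = {..<d}\<close>.
\<close>

definition multi_indices :: "nat \<Rightarrow> 'i set \<Rightarrow> (nat \<Rightarrow> 'i) set" where
  "multi_indices k I = {..<k} \<rightarrow>\<^sub>E I"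

definition tensors :: "nat \<Rightarrow> 'i set \<Rightarrow> ((nat \<Rightarrow> 'i) \<Rightarrow> 'a) set" where
  "tensors k I = multi_indices k I \<rightarrow>\<^sub>E UNIV"

definition symmetric_tensor :: "nat \<Rightarrow> 'i set \<Rightarrow> ((nat \<Rightarrow> 'i) \<Rightarrow> 'a) \<Rightarrow> bool" where
  "symmetric_tensor k I f \<longleftrightarrow> f \<in> tensors k I \<and>
     (\<forall>i \<in> multi_indices k I. \<forall>\<sigma>. \<sigma> permutes {..<k} \<longrightarrow> f (i \<circ> \<sigma>) = f i)"

text \<open>The product below is the \<open>i\<close>-coordinate of the \<open>k\<close>-th tensor power of the basis vector \<open>e\<^sub>j\<close>.\<close>

definition unit_tensor :: "nat \<Rightarrow> nat \<Rightarrow> (nat \<Rightarrow> nat) \<Rightarrow> 'a::field" where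
  "unit_tensor k r = (\<lambda>i \<in> multi_indices k {..<r}. \<Sum>j<r. \<Prod>l<k. if i l = j then 1 else 0)"

text \<open>
  The image of \<open>f\<close> under \<open>A\<^sub>0 \<otimes> \<dots> \<otimes> A\<^sub>k\<^sub>-\<^sub>1\<close>. The linear map \<open>A\<^sub>l\<close> from \<open>F\<^sup>I\<close> to \<open>F\<^sup>r\<close> is given by
  its matrix, with rows indexed by \<open>{..<r}\<close> and columns by \<open>I\<close>; other entries of \<open>A l\<close> play no role.
\<close>

definition apply_maps ::
  "nat \<Rightarrow> 'i set \<Rightarrow> nat \<Rightarrow> (nat \<Rightarrow> nat \<Rightarrow> 'i \<Rightarrow> 'a::field) \<Rightarrow> ((nat \<Rightarrow> 'i) \<Rightarrow> 'a) \<Rightarrow> (nat \<Rightarrow> nat) \<Rightarrow> 'a"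
where
  "apply_maps k I r A f =
     (\<lambda>i \<in> multi_indices k {..<r}. \<Sum>j \<in> multi_indices k I. (\<Prod>l<k. A l (i l) (j l)) * f j)"

text \<open>
  For finite \<open>I\<close> and \<open>k \<ge> 2\<close> the maxima exist: \<open>r = 0\<close> is always admissible, and comparing
  flattening ranks gives \<open>r \<le> card I\<close>.
\<close>

definition subrank :: "nat \<Rightarrow> 'i set \<Rightarrow> ((nat \<Rightarrow> 'i) \<Rightarrow> 'a::field) \<Rightarrow> nat" where
  "subrank k I f =
     (GREATEST r. \<exists>A :: nat \<Rightarrow> nat \<Rightarrow> 'i \<Rightarrow> 'a. unit_tensor k r = apply_maps k I r A f)"

definition symmetric_subrank :: "nat \<Rightarrow> 'i set \<Rightarrow> ((nat \<Rightarrow> 'i) \<Rightarrow> 'a::field) \<Rightarrow> nat" where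
  "symmetric_subrank k I f =
     (GREATEST r. \<exists>A :: nat \<Rightarrow> 'i \<Rightarrow> 'a. unit_tensor k r = apply_maps k I r (\<lambda>_. A) f)"

text \<open>
  The Kronecker power is a \<open>k\<close>-tensor whose legs are indexed by the standard basis of
  \<open>(F\<^sup>I)\<^sup>\<otimes>\<^sup>n\<close>, that is by \<open>multi_indices n I\<close> (of cardinality \<open>d\<^sup>n\<close> for \<open>I = {..<d}\<close>).
  The \<open>m\<close>-th copy of \<open>f\<close> reads the \<open>m\<close>-th component of every leg.
\<close>

definition kronecker_power ::
  "nat \<Rightarrow> 'i set \<Rightarrow> ((nat \<Rightarrow> 'i) \<Rightarrow> 'a::field) \<Rightarrow> nat \<Rightarrow> (nat \<Rightarrow> nat \<Rightarrow> 'i) \<Rightarrow> 'a" where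
  "kronecker_power k I f n =
     (\<lambda>J \<in> multi_indices k (multi_indices n I). \<Prod>m<n. f (\<lambda>l\<in>{..<k}. J l m))"

end

(*
  An unrestricted reduction of f to a unit tensor of size r is given by row vectors a_{l,i}, one family
  for each leg l. By the polarization identity
    sum_{S subset of [k]} (-1)^(k-|S|) f(sum_{l in S} a_{l,i_1}, ..., sum_{l in S} a_{l,i_k})
      = sum_sigma f(a_{sigma(1),i_1}, ..., a_{sigma(k),i_k}) = k! [i_1 = ... = i_k],
  the tensor product of f with a unit tensor of size 2^k, indexed by the sets S, restricts
  symmetrically to the unit tensor of size r. Here the size 2^k does not depend on r. If some fixed
  power of f restricts symmetrically to a unit tensor of size 2^k, then
  Q(f^n) <= Q_s(f^(n + m)) for a constant m, and the limits agree by Fekete's lemma.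

  Such a power exists as soon as Q(f^n) >= 2 for some n; otherwise all values are at most 1. Replace f by
  f^n. Its homogeneous polynomial has a zero v for which f(v, ...) does not vanish identically, whence
  vectors u, v and 0 < p < k such that f(u^j v^(k-j)) is 0 for j < p but not for j = p. A power of f,
  tested on suitable products of u and v, then restricts to a symmetric unit tensor of size 2.
*)

theory Submission
  imports Defs "HOL-Library.Function_Algebras" "HOL-Real_Asymp.Real_Asymp"
begin

section \<open>Multilinear forms and polarization\<close>

text \<open>The tensor as a k-linear form on coordinate vectors. An entry of an image under
  \<open>apply_maps\<close> is this form evaluated at one row of each matrix, so restrictions become
  statements about its values.\<close>

definition multiform :: "nat \<Rightarrow> 'i set \<Rightarrow> ((nat \<Rightarrow> 'i) \<Rightarrow> 'a::field) \<Rightarrow> (nat \<Rightarrow> 'i \<Rightarrow> 'a) \<Rightarrow> 'a" where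
  "multiform k I f x = (\<Sum>j\<in>multi_indices k I. (\<Prod>l<k. x l (j l)) * f j)"

lemma finite_multi_indices [simp]: "finite I \<Longrightarrow> finite (multi_indices k I)"
  by (simp add: multi_indices_def finite_PiE)

lemma multiform_cong:
  assumes "\<And>l i. l < k \<Longrightarrow> i \<in> I \<Longrightarrow> x l i = y l i"
  shows "multiform k I f x = multiform k I f y"
  unfolding multiform_def
proof (rule sum.cong[OF refl])
  fix j assume "j \<in> multi_indices k I"
  then have "\<And>l. l < k \<Longrightarrow> x l (j l) = y l (j l)"
    using assms by (auto simp: multi_indices_def)
  then show "(\<Prod>l<k. x l (j l)) * f j = (\<Prod>l<k. y l (j l)) * f j"
    by simp
qed

lemma multiform_scale:
  "multiform k I f (\<lambda>l i. c l * x l i) = (\<Prod>l<k. c l) * multiform k I f x"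
  by (simp add: multiform_def prod.distrib sum_distrib_left mult.assoc)

lemma multiform_sum:
  assumes "\<And>l. l < k \<Longrightarrow> finite (S l)"
  shows "multiform k I f (\<lambda>l i. \<Sum>s\<in>S l. y l s i) =
    (\<Sum>t\<in>PiE {..<k} S. multiform k I f (\<lambda>l. y l (t l)))"
proof -
  have "multiform k I f (\<lambda>l i. \<Sum>s\<in>S l. y l s i) =
     (\<Sum>j\<in>multi_indices k I. \<Sum>t\<in>PiE {..<k} S. (\<Prod>l<k. y l (t l) (j l)) * f j)"
    unfolding multiform_def using assms
    by (intro sum.cong refl) (subst prod_sum_PiE, auto simp: sum_distrib_right)
  then show ?thesis
    unfolding multiform_def by (simp add: sum.swap[of _ "multi_indices k I"])
qed

text \<open>The substitution of \<open>j \<circ> inv \<sigma>\<close> for \<open>j\<close> moves the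
  permutation from the vectors to the multi-index, where the symmetry of \<open>f\<close> absorbs
  it.\<close>

lemma multiform_permute:
  assumes "symmetric_tensor k I f" "\<sigma> permutes {..<k}"
  shows "multiform k I f (\<lambda>l. x (\<sigma> l)) = multiform k I f x"
proof -
  have inv: "inv \<sigma> permutes {..<k}"
    using assms(2) by (rule permutes_inv)
  have closed: "j \<circ> \<tau> \<in> multi_indices k I"
    if "j \<in> multi_indices k I" "\<tau> permutes {..<k}" for j \<tau>
    using that permutes_in_image[OF that(2)] permutes_not_in[OF that(2)]
    by (fastforce simp: multi_indices_def PiE_iff extensional_def)
  show ?thesis
    unfolding multiform_def
  proof (rule sum.reindex_bij_witness[of _ "\<lambda>j. j \<circ> \<sigma>" "\<lambda>j. j \<circ> inv \<sigma>"])
    fix j assume j: "j \<in> multi_indices k I"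
    show "j \<circ> inv \<sigma> \<circ> \<sigma> = j" "j \<circ> \<sigma> \<circ> inv \<sigma> = j"
      using permutes_inv_o[OF assms(2)] by (simp_all add: comp_assoc)
    show "j \<circ> inv \<sigma> \<in> multi_indices k I" "j \<circ> \<sigma> \<in> multi_indices k I"
      using closed j assms(2) inv by auto
    have "(\<Prod>l<k. x (\<sigma> l) (j l)) = (\<Prod>l<k. x l ((j \<circ> inv \<sigma>) l))"
      using prod.permute[OF assms(2), of "\<lambda>l. x l ((j \<circ> inv \<sigma>) l)"] permutes_inverses(2)[OF assms(2)]
      by (simp add: o_def)
    then show "(\<Prod>l<k. x l ((j \<circ> inv \<sigma>) l)) * f (j \<circ> inv \<sigma>) = (\<Prod>l<k. x (\<sigma> l) (j l)) * f j"
      using assms(1) inv j by (simp add: symmetric_tensor_def)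
  qed
qed

text \<open>Expand the product over \<open>A\<close> of \<open>1 + g\<close>, with g = 0 on
  \<open>R\<close> and g = -1 elsewhere: the terms that survive are those with
  \<open>R \<subseteq> S\<close>, while the product itself has a zero factor unless R = A.\<close>

lemma alternating_sum_supersets:
  assumes "finite A" "R \<subseteq> A"
  shows "(\<Sum>S | R \<subseteq> S \<and> S \<subseteq> A. (-1) ^ card (A - S)) = (if R = A then 1 else 0 :: 'a::comm_ring_1)"
proof -
  let ?g = "\<lambda>j. if j \<in> R then 0 else - 1 :: 'a"
  have g: "(\<Prod>x\<in>A - S. ?g x) = (if R \<subseteq> S then (-1) ^ card (A - S) else 0)" for S
  proof (cases "R \<subseteq> S")
    case True
    then have "(\<Prod>x\<in>A - S. ?g x) = (\<Prod>x\<in>A - S. -1)"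
      by (intro prod.cong) auto
    then show ?thesis using True by simp
  next
    case False
    then show ?thesis using assms by (auto intro!: prod_zero)
  qed
  have "(\<Prod>j\<in>A. 1 + ?g j) = (\<Sum>S\<in>Pow A. if R \<subseteq> S then (-1) ^ card (A - S) else 0)"
    by (simp add: prod_add[OF assms(1)] g)
  also have "\<dots> = (\<Sum>S | R \<subseteq> S \<and> S \<subseteq> A. (-1) ^ card (A - S))"
    using assms by (intro sum.mono_neutral_cong_right) auto
  also have "(\<Prod>j\<in>A. 1 + ?g j) = (if R = A then 1 else 0)"
  proof (cases "R = A")
    case False
    then obtain j where "j \<in> A" "j \<notin> R" using assms by blast
    then have "\<exists>j\<in>A. 1 + ?g j = 0" by (intro bexI[of _ j]) auto
    then show ?thesis using False assms prod_zero by (metis (no_types, lifting))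
  qed simp
  finally show ?thesis by simp
qed

text \<open>Translates between two encodings: permutations are the identity outside
  \<open>{..<k}\<close>, choice functions are undefined there. A surjection of a finite set onto
  itself is injective.\<close>

lemma surj_PiE_permutes:
  "bij_betw (\<lambda>\<sigma>. restrict \<sigma> {..<k}) {\<sigma>. \<sigma> permutes {..<k}}
     {t \<in> {..<k} \<rightarrow>\<^sub>E {..<k}. t ` {..<k} = {..<k::nat}}"
proof (rule bij_betw_byWitness[where f' = "\<lambda>t l. if l < k then t l else l"])
  show "\<forall>\<sigma>\<in>{\<sigma>. \<sigma> permutes {..<k}}. (\<lambda>l. if l < k then restrict \<sigma> {..<k} l else l) = \<sigma>"
    by (auto simp: permutes_not_in)
  show "\<forall>t\<in>{t \<in> {..<k} \<rightarrow>\<^sub>E {..<k}. t ` {..<k} = {..<k}}.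
      (\<lambda>l\<in>{..<k}. if l < k then t l else l) = t"
    by (auto simp: PiE_iff extensional_def restrict_def)
  show "(\<lambda>\<sigma>. restrict \<sigma> {..<k}) ` {\<sigma>. \<sigma> permutes {..<k}} \<subseteq>
      {t \<in> {..<k} \<rightarrow>\<^sub>E {..<k}. t ` {..<k} = {..<k}}"
  proof (rule image_subsetI)
    fix \<sigma> assume "\<sigma> \<in> {\<sigma>. \<sigma> permutes {..<k}}"
    then have "\<sigma> permutes {..<k}" by simp
    then show "restrict \<sigma> {..<k} \<in> {t \<in> {..<k} \<rightarrow>\<^sub>E {..<k}. t ` {..<k} = {..<k}}"
      using permutes_image[of \<sigma> "{..<k}"] by (auto simp: image_subset_iff)
  qed
  show "(\<lambda>t l. if l < k then t l else l) ` {t \<in> {..<k} \<rightarrow>\<^sub>E {..<k}. t ` {..<k} = {..<k}} \<subseteq>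
      {\<sigma>. \<sigma> permutes {..<k}}"
  proof clarify
    fix t :: "nat \<Rightarrow> nat" assume t: "t ` {..<k} = {..<k}"
    then have "inj_on t {..<k}" by (simp add: eq_card_imp_inj_on)
    then have "bij_betw (\<lambda>l. if l < k then t l else l) {..<k} {..<k}"
      using t by (subst bij_betw_cong[of _ _ t]) (auto simp: bij_betw_def)
    then show "(\<lambda>l. if l < k then t l else l) permutes {..<k}"
      by (rule bij_imp_permutes) simp
  qed
qed

text \<open>Multilinear expansion gives choice functions \<open>t\<close> with values in
  \<open>S\<close>. After exchanging the sums, each \<open>t\<close> is weighted by the alternating
  sum over all \<open>S\<close> containing its image, which vanishes unless \<open>t\<close> is
  onto. The vectors depend on the leg \<open>l\<close> besides the label \<open>s\<close>, because
  different legs will carry different rows.\<close>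

lemma polarization:
  fixes f :: "(nat \<Rightarrow> 'i) \<Rightarrow> 'a::field"
  shows "(\<Sum>S\<in>Pow {..<k}. (-1) ^ card ({..<k} - S) * multiform k I f (\<lambda>l i. \<Sum>s\<in>S. y s l i)) =
   (\<Sum>\<sigma> | \<sigma> permutes {..<k}. multiform k I f (\<lambda>l. y (\<sigma> l) l))"
proof -
  let ?m = "\<lambda>t. multiform k I f (\<lambda>l. y (t l) l)"
  let ?E = "{..<k} \<rightarrow>\<^sub>E {..<k}"
  let ?c = "\<lambda>S. (-1) ^ card ({..<k} - S) :: 'a"
  have "(\<Sum>S\<in>Pow {..<k}. ?c S * multiform k I f (\<lambda>l i. \<Sum>s\<in>S. y s l i)) =
    (\<Sum>S\<in>Pow {..<k}. \<Sum>t\<in>{..<k} \<rightarrow>\<^sub>E S. ?c S * ?m t)"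
    by (intro sum.cong refl, subst multiform_sum) (auto simp: sum_distrib_left intro: finite_subset)
  also have "\<dots> = (\<Sum>S\<in>Pow {..<k}. \<Sum>t\<in>?E. if t ` {..<k} \<subseteq> S then ?c S * ?m t else 0)"
    by (intro sum.cong refl sum.mono_neutral_cong_left) (auto simp: finite_PiE PiE_iff image_subset_iff)
  also have "\<dots> = (\<Sum>t\<in>?E. \<Sum>S\<in>Pow {..<k}. if t ` {..<k} \<subseteq> S then ?c S * ?m t else 0)"
    by (rule sum.swap)
  also have "\<dots> = (\<Sum>t\<in>?E. (\<Sum>S | t ` {..<k} \<subseteq> S \<and> S \<subseteq> {..<k}. ?c S) * ?m t)"
    by (intro sum.cong refl) (auto simp: sum_distrib_right image_subset_iff intro!: sum.mono_neutral_cong_right split: if_splits)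
  also have "\<dots> = (\<Sum>t\<in>?E. if t ` {..<k} = {..<k} then ?m t else 0)"
    by (intro sum.cong refl, subst alternating_sum_supersets) auto
  also have "\<dots> = (\<Sum>t | t \<in> ?E \<and> t ` {..<k} = {..<k}. ?m t)"
    by (intro sum.mono_neutral_cong_right) (auto simp: finite_PiE)
  also have "\<dots> = (\<Sum>\<sigma> | \<sigma> permutes {..<k}. ?m (restrict \<sigma> {..<k}))"
    by (rule sum.reindex_bij_betw[OF surj_PiE_permutes, symmetric])
  also have "\<dots> = (\<Sum>\<sigma> | \<sigma> permutes {..<k}. ?m \<sigma>)"
    by (intro sum.cong refl multiform_cong) auto
  finally show ?thesis .
qed

text \<open>For vectors independent of the leg all k! permuted terms coincide. Thus a symmetric form
  with a nonzero value has one on the diagonal as well, provided that k! is invertible.\<close>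

lemma polarization_symmetric:
  fixes f :: "(nat \<Rightarrow> 'i) \<Rightarrow> 'a::field"
  assumes "symmetric_tensor k I f"
  shows "(\<Sum>S\<in>Pow {..<k}. (-1) ^ card ({..<k} - S) * multiform k I f (\<lambda>_ i. \<Sum>s\<in>S. x s i)) =
    of_nat (fact k) * multiform k I f x"
  using polarization[of k I f "\<lambda>s _. x s"]
  by (simp add: multiform_permute[OF assms] card_permutations)

section \<open>Kronecker powers\<close>

text \<open>Coordinates of the tensor product of \<open>x\<close> and \<open>y\<close>: a
  multi-index of length n + m is cut into its first n and its last m entries, and the restrictions
  make both blocks extensional.\<close>

definition kron_vec ::
  "nat \<Rightarrow> nat \<Rightarrow> ((nat \<Rightarrow> 'i) \<Rightarrow> 'a::field) \<Rightarrow> ((nat \<Rightarrow> 'i) \<Rightarrow> 'a) \<Rightarrow> (nat \<Rightarrow> 'i) \<Rightarrow> 'a" where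
  "kron_vec n m x y = (\<lambda>J. x (\<lambda>j\<in>{..<n}. J j) * y (\<lambda>j\<in>{..<m}. J (n + j)))"

text \<open>Coordinates of the tensor product of \<open>z (M - 1)\<close>, ..., \<open>z 0\<close>,
  in this order, each factor occupying a block of length n.\<close>

primrec kron_power_vec ::
  "nat \<Rightarrow> nat \<Rightarrow> (nat \<Rightarrow> (nat \<Rightarrow> 'i) \<Rightarrow> 'a::field) \<Rightarrow> (nat \<Rightarrow> 'i) \<Rightarrow> 'a" where
  "kron_power_vec n 0 z = (\<lambda>_. 1)"
| "kron_power_vec n (Suc M) z = kron_vec n (M * n) (z M) (kron_power_vec n M z)"

abbreviation kron_form ::
  "nat \<Rightarrow> 'i set \<Rightarrow> ((nat \<Rightarrow> 'i) \<Rightarrow> 'a::field) \<Rightarrow> nat \<Rightarrow> (nat \<Rightarrow> (nat \<Rightarrow> 'i) \<Rightarrow> 'a) \<Rightarrow> 'a" where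
  "kron_form k I f n \<equiv> multiform k (multi_indices n I) (kronecker_power k I f n)"

lemma prod_lessThan_add:
  fixes g :: "nat \<Rightarrow> 'a::comm_monoid_mult"
  shows "(\<Prod>q<n + m. g q) = (\<Prod>q<n. g q) * (\<Prod>q<m. g (n + q))"
  by (induction m) (simp_all add: mult.assoc)

text \<open>A k-row array of length n + m is a pair of arrays obtained by cutting every row after n
  entries. Both the vectors and the Kronecker power factor along this cut, so the sum over arrays is
  a product of two sums.\<close>

lemma kron_form_kron_vec:
  fixes f :: "(nat \<Rightarrow> 'i) \<Rightarrow> 'a::field"
  shows "kron_form k I f (n + m) (\<lambda>l. kron_vec n m (x l) (y l)) =
    kron_form k I f n x * kron_form k I f m y"
proof -
  let ?N = "multi_indices k (multi_indices n I)" and ?M = "multi_indices k (multi_indices m I)"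
  let ?join = "\<lambda>(J, K). \<lambda>l\<in>{..<k}. \<lambda>j\<in>{..<n + m}. if j < n then J l j else K l (j - n)"
  let ?split = "\<lambda>P. (\<lambda>l\<in>{..<k}. \<lambda>j\<in>{..<n}. P l j, \<lambda>l\<in>{..<k}. \<lambda>j\<in>{..<m}. P l (n + j))"
  let ?g = "\<lambda>J. (\<Prod>l<k. x l (J l)) * kronecker_power k I f n J"
  let ?h = "\<lambda>K. (\<Prod>l<k. y l (K l)) * kronecker_power k I f m K"
  have "kron_form k I f n x * kron_form k I f m y = (\<Sum>(J, K)\<in>?N \<times> ?M. ?g J * ?h K)"
    by (simp add: multiform_def sum_product sum.cartesian_product)
  also have "\<dots> = (\<Sum>P\<in>multi_indices k (multi_indices (n + m) I).
      (\<Prod>l<k. kron_vec n m (x l) (y l) (P l)) * kronecker_power k I f (n + m) P)"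
  proof (rule sum.reindex_bij_witness[of _ ?split ?join], goal_cases)
    case (1 JK)
    then show ?case
      by (auto simp: multi_indices_def PiE_iff extensional_def restrict_def fun_eq_iff)
  next
    case (2 JK)
    then show ?case
      by (auto simp: multi_indices_def PiE_iff)
  next
    case (3 P)
    then show ?case
      by (auto simp: multi_indices_def PiE_iff extensional_def restrict_def fun_eq_iff)
  next
    case (4 P)
    then show ?case
      by (auto simp: multi_indices_def PiE_iff)
  next
    case (5 JK)
    obtain J K where JK: "JK = (J, K)" "J \<in> ?N" "K \<in> ?M"
      using 5 by auto
    define P where "P = ?join (J, K)"
    have P: "P \<in> multi_indices k (multi_indices (n + m) I)"
      using JK(2,3) unfolding P_def by (auto simp: multi_indices_def PiE_iff)
    have r1: "(\<lambda>j\<in>{..<n}. P l j) = J l" and r2: "(\<lambda>j\<in>{..<m}. P l (n + j)) = K l"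
      if "l < k" for l
      using that JK(2,3) unfolding P_def
      by (auto simp: multi_indices_def PiE_iff extensional_def restrict_def fun_eq_iff)
    have prod_eq: "(\<Prod>l<k. kron_vec n m (x l) (y l) (P l)) = (\<Prod>l<k. x l (J l)) * (\<Prod>l<k. y l (K l))"
      unfolding prod.distrib[symmetric]
      by (rule prod.cong[OF refl]) (simp add: kron_vec_def r1 r2)
    have a: "(\<lambda>l\<in>{..<k}. P l q) = (\<lambda>l\<in>{..<k}. J l q)" if "q < n" for q
      using that by (auto simp: P_def restrict_def)
    have b: "(\<lambda>l\<in>{..<k}. P l (n + q)) = (\<lambda>l\<in>{..<k}. K l q)" if "q < m" for q
      using that by (auto simp: P_def restrict_def)
    have "kronecker_power k I f (n + m) P =
        kronecker_power k I f n J * kronecker_power k I f m K"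
      using P JK(2,3) by (simp add: kronecker_power_def prod_lessThan_add a b)
    then have "(\<Prod>l<k. kron_vec n m (x l) (y l) (P l)) * kronecker_power k I f (n + m) P =
        ?g J * ?h K"
      by (simp add: prod_eq)
    then show ?case
      unfolding JK(1) P_def by simp
  qed
  finally show ?thesis
    by (simp add: multiform_def)
qed

lemma multi_indices_singleton: "multi_indices k {a} = {\<lambda>l\<in>{..<k}. a}"
  by (auto simp: multi_indices_def PiE_singleton restrict_def PiE_iff extensional_def fun_eq_iff)

lemma kron_form_0: "kron_form k I f 0 (\<lambda>l _. 1) = 1"
proof -
  \<comment> \<open>The empty power has a single index in each leg, the nowhere defined extensional
    function, and its only entry is the empty product 1.\<close>
  have "multi_indices 0 I = {\<lambda>_. undefined}"
    by (simp add: multi_indices_def)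
  then show ?thesis
    by (simp add: multiform_def multi_indices_singleton kronecker_power_def)
qed

lemma kron_form_power:
  "kron_form k I f (M * n) (\<lambda>l. kron_power_vec n M (z l)) = (\<Prod>t<M. kron_form k I f n (\<lambda>l. z l t))"
proof (induction M)
  case 0
  then show ?case using kron_form_0[of k I f] by simp
next
  case (Suc M)
  then show ?case by (simp add: kron_form_kron_vec mult.commute)
qed

lemma symmetric_kronecker_power:
  assumes "symmetric_tensor k I f"
  shows "symmetric_tensor k (multi_indices n I) (kronecker_power k I f n)"
  unfolding symmetric_tensor_def
proof (intro conjI ballI allI impI)
  show "kronecker_power k I f n \<in> tensors k (multi_indices n I)"
    by (simp add: kronecker_power_def tensors_def)
  fix J \<sigma> assume J: "J \<in> multi_indices k (multi_indices n I)" and \<sigma>: "\<sigma> permutes {..<k}"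
  have J\<sigma>: "J \<circ> \<sigma> \<in> multi_indices k (multi_indices n I)"
    using J permutes_in_image[OF \<sigma>] permutes_not_in[OF \<sigma>]
    by (fastforce simp: multi_indices_def PiE_iff extensional_def)
  have "f (\<lambda>l\<in>{..<k}. (J \<circ> \<sigma>) l q) = f (\<lambda>l\<in>{..<k}. J l q)" if "q < n" for q
  proof -
    have "(\<lambda>l\<in>{..<k}. (J \<circ> \<sigma>) l q) = (\<lambda>l\<in>{..<k}. J l q) \<circ> \<sigma>"
      using permutes_in_image[OF \<sigma>] by (auto simp: restrict_def fun_eq_iff)
    moreover have "(\<lambda>l\<in>{..<k}. J l q) \<in> multi_indices k I"
      using J that by (auto simp: multi_indices_def PiE_iff)
    ultimately show ?thesis
      using assms \<sigma> by (simp add: symmetric_tensor_def)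
  qed
  then show "kronecker_power k I f n (J \<circ> \<sigma>) = kronecker_power k I f n J"
    using J J\<sigma> by (simp add: kronecker_power_def)
qed

section \<open>Restrictions to unit tensors\<close>

text \<open>\<open>A l s\<close> is the row labelled \<open>s\<close> of the map in leg
  \<open>l\<close>. Labels come from an arbitrary set, so that pairs, booleans and subsets can serve
  directly; a restriction of the form \<open>\<lambda>_. B\<close> is a symmetric one.\<close>

definition unit_restriction ::
  "nat \<Rightarrow> 'i set \<Rightarrow> ((nat \<Rightarrow> 'i) \<Rightarrow> 'a::field) \<Rightarrow> 't set \<Rightarrow> (nat \<Rightarrow> 't \<Rightarrow> 'i \<Rightarrow> 'a) \<Rightarrow> bool" where
  "unit_restriction k I f T A \<longleftrightarrow> (\<forall>t\<in>{..<k} \<rightarrow> T.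
     multiform k I f (\<lambda>l. A l (t l)) = (if \<exists>s. \<forall>l<k. t l = s then 1 else 0))"

lemma unit_restrictionD:
  assumes "unit_restriction k I f T A" "\<And>l. l < k \<Longrightarrow> t l \<in> T"
  shows "multiform k I f (\<lambda>l. A l (t l)) = (if \<exists>s. \<forall>l<k. t l = s then 1 else 0)"
  using assms by (simp add: unit_restriction_def Pi_iff)

lemma unit_tensor_eq_apply_maps_iff:
  fixes f :: "(nat \<Rightarrow> 'i) \<Rightarrow> 'a::field"
  assumes "k > 0"
  shows "unit_tensor k r = apply_maps k I r A f \<longleftrightarrow> unit_restriction k I f {..<r} A"
proof -
  have unit: "(\<Sum>j<r. \<Prod>l<k. if i l = j then 1 else 0) = (if \<exists>s. \<forall>l<k. i l = s then 1 else 0 :: 'a)"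
    if "i \<in> {..<k} \<rightarrow> {..<r}" for i :: "nat \<Rightarrow> nat"
  proof -
    have "(\<Prod>l<k. if i l = j then 1 else 0) = (if \<forall>l<k. i l = j then 1 else 0 :: 'a)" for j
      by (auto intro: prod_zero)
    \<comment> \<open>Only j = i 0 can contribute, so the sum collapses to one term.\<close>
    moreover have "(\<Sum>j<r. if \<forall>l<k. i l = j then 1 else 0 :: 'a) = (\<Sum>j<r. if i 0 = j then (if \<forall>l<k. i l = j then 1 else 0) else 0)"
      using assms by (intro sum.cong) auto
    moreover have "(\<forall>l<k. i l = i 0) \<longleftrightarrow> (\<exists>s. \<forall>l<k. i l = s)"
      using assms by metis
    ultimately show ?thesis
      using that assms by (simp add: Pi_iff)
  qed
  show ?thesis
  proof
    assume eq: "unit_tensor k r = apply_maps k I r A f"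
    show "unit_restriction k I f {..<r} A"
      unfolding unit_restriction_def
    proof
      fix t assume t: "t \<in> {..<k} \<rightarrow> {..<r}"
      then have "restrict t {..<k} \<in> multi_indices k {..<r}"
        by (auto simp: multi_indices_def)
      then have "multiform k I f (\<lambda>l. A l (restrict t {..<k} l)) =
          (\<Sum>j<r. \<Prod>l<k. if restrict t {..<k} l = j then 1 else 0)"
        using fun_cong[OF eq, of "restrict t {..<k}"]
        by (simp add: unit_tensor_def apply_maps_def multiform_def)
      also have "\<dots> = (if \<exists>s. \<forall>l<k. t l = s then 1 else 0)"
        using unit[OF t] by simp
      also have "multiform k I f (\<lambda>l. A l (restrict t {..<k} l)) = multiform k I f (\<lambda>l. A l (t l))"
        by (rule multiform_cong) simp
      finally show "multiform k I f (\<lambda>l. A l (t l)) = (if \<exists>s. \<forall>l<k. t l = s then 1 else 0)" .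
    qed
  next
    assume res: "unit_restriction k I f {..<r} A"
    show "unit_tensor k r = apply_maps k I r A f"
      unfolding unit_tensor_def apply_maps_def
    proof (rule restrict_ext)
      fix i assume i: "i \<in> multi_indices k {..<r}"
      then have "i \<in> {..<k} \<rightarrow> {..<r}"
        by (auto simp: multi_indices_def)
      then show "(\<Sum>j<r. \<Prod>l<k. if i l = j then 1 else 0) =
          (\<Sum>j\<in>multi_indices k I. (\<Prod>l<k. A l (i l) (j l)) * f j)"
        using res unit[of i] by (simp add: unit_restriction_def multiform_def)
    qed
  qed
qed

section \<open>Dimension bound and attainment of the maxima\<close>

lemma multiform_sum_first:
  assumes "k > 0"
  shows "multiform k I f (x(0 := \<lambda>i. \<Sum>s\<in>T. c s * y s i)) =
    (\<Sum>s\<in>T. c s * multiform k I f (x(0 := y s)))"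
proof -
  obtain m where k: "k = Suc m"
    using assms gr0_implies_Suc by auto
  have "multiform k I f (x(0 := z)) =
      (\<Sum>j\<in>multi_indices k I. z (j 0) * ((\<Prod>l<m. x (Suc l) (j (Suc l))) * f j))" for z
    unfolding multiform_def k by (simp add: prod.lessThan_Suc_shift mult.assoc del: prod.lessThan_Suc)
  then show ?thesis
    by (simp add: sum_distrib_left sum_distrib_right mult.assoc sum.swap[of _ T])
qed

lemma sum_fun_apply: "(\<Sum>s\<in>T. g s) x = (\<Sum>s\<in>T. g s x)"
  by (induction T rule: infinite_finite_induct) simp_all

text \<open>Fixing the legs other than 0 at a label s' gives a linear functional that is 1 on the
  row s' of leg 0 and 0 on its other rows; as k is at least 2, there is a leg to see s'. Hence these
  rows are independent in a space of dimension at most \<open>card I\<close>.\<close>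

lemma unit_restriction_card_le:
  fixes f :: "(nat \<Rightarrow> 'i) \<Rightarrow> 'a::field"
  assumes "unit_restriction k I f T A" "k \<ge> 2" "finite I" "finite T"
  shows "card T \<le> card I"
proof -
  interpret vs: vector_space "\<lambda>(c::'a) (v::'i \<Rightarrow> 'a) i. c * v i"
    by unfold_locales (simp_all add: fun_eq_iff algebra_simps)
  \<comment> \<open>Rows are cut off outside \<open>I\<close>, so that they lie in the span of the
    unit vectors indexed by \<open>I\<close>.\<close>
  define w where "w s = (\<lambda>i. if i \<in> I then A 0 s i else 0)" for s
  define e where "e q = (\<lambda>i. if i = q then 1 else 0 :: 'a)" for q :: 'i
  have dual: "multiform k I f ((\<lambda>l. A l s')(0 := w s)) = (if s = s' then 1 else 0)"
    if "s \<in> T" "s' \<in> T" for s s'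
  proof -
    have "multiform k I f ((\<lambda>l. A l s')(0 := w s)) = multiform k I f (\<lambda>l. A l (if l = 0 then s else s'))"
      by (rule multiform_cong) (simp add: w_def)
    also have "\<dots> = (if \<exists>u. \<forall>l<k. (if l = 0 then s else s') = u then 1 else 0)"
      using that by (intro unit_restrictionD[OF assms(1)]) auto
    also have "(\<exists>u. \<forall>l<k. (if l = 0 then s else s') = u) \<longleftrightarrow> s = s'"
    proof
      assume "\<exists>u. \<forall>l<k. (if l = 0 then s else s') = u"
      then obtain u where u: "\<And>l. l < k \<Longrightarrow> (if l = 0 then s else s') = u" by blast
      show "s = s'" using u[of 0] u[of 1] assms(2) by simp
    qed auto
    finally show ?thesis .
  qed
  have inj: "inj_on w T"
    by (rule inj_onI) (metis dual zero_neq_one)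
  have "vs.independent (w ` T)"
  proof (rule vs.independent_if_scalars_zero)
    show "finite (w ` T)" using assms(4) by simp
    fix c v assume sum0: "(\<Sum>v\<in>w ` T. (\<lambda>i. c v * v i)) = 0" and "v \<in> w ` T"
    then obtain s' where s': "s' \<in> T" "v = w s'" by blast
    have "(\<lambda>i. \<Sum>s\<in>T. c (w s) * w s i) = (\<lambda>_. 0)"
      using fun_cong[OF sum0] by (simp add: sum_fun_apply sum.reindex[OF inj] fun_eq_iff)
    then have "(\<Sum>s\<in>T. c (w s) * multiform k I f ((\<lambda>l. A l s')(0 := w s))) =
        multiform k I f ((\<lambda>l. A l s')(0 := \<lambda>_. 0))"
      using assms(2) multiform_sum_first[of k I f "\<lambda>l. A l s'" "\<lambda>s. c (w s)" w T] by simp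
    also have "\<dots> = 0"
      using assms(2) multiform_sum_first[of k I f "\<lambda>l. A l s'" c id "{}"] by simp
    also have "(\<Sum>s\<in>T. c (w s) * multiform k I f ((\<lambda>l. A l s')(0 := w s))) =
        (\<Sum>s\<in>T. if s = s' then c (w s) else 0)"
      using s' by (intro sum.cong) (simp_all add: dual)
    finally show "c v = 0"
      using s' assms(4) by simp
  qed
  moreover have "w ` T \<subseteq> vs.span (e ` I)"
  proof clarify
    fix s assume "s \<in> T"
    have "w s = (\<Sum>q\<in>I. (\<lambda>i. w s q * e q i))"
      using assms(3) by (auto simp: fun_eq_iff sum_fun_apply e_def w_def if_distrib[of "(*) _"] cong: if_cong)
    also have "\<dots> \<in> vs.span (e ` I)"
      by (intro vs.span_sum vs.span_scale vs.span_base) simp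
    finally show "w s \<in> vs.span (e ` I)" .
  qed
  ultimately have "card (w ` T) \<le> card (e ` I)"
    using assms(3) by (intro vs.independent_span_bound[THEN conjunct2]) simp_all
  then show ?thesis
    using card_image[OF inj] card_image_le[OF assms(3), of e] by simp
qed

lemma unit_restriction_reindex:
  assumes "unit_restriction k I f T A" "inj_on h T'" "h ` T' \<subseteq> T"
  shows "unit_restriction k I f T' (\<lambda>l s. A l (h s))"
  unfolding unit_restriction_def
proof
  fix t assume t: "t \<in> {..<k} \<rightarrow> T'"
  then have "multiform k I f (\<lambda>l. A l (h (t l))) = (if \<exists>s. \<forall>l<k. h (t l) = s then 1 else 0)"
    using assms(3) by (intro unit_restrictionD[OF assms(1)]) auto
  moreover have "(\<exists>s. \<forall>l<k. h (t l) = s) \<longleftrightarrow> (\<exists>s. \<forall>l<k. t l = s)"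
  proof
    assume "\<exists>s. \<forall>l<k. h (t l) = s"
    then have "t l = t 0" if "l < k" for l
      using that t assms(2) by (metis Pi_mem gr_zeroI inj_onD lessThan_iff not_less_zero)
    then show "\<exists>s. \<forall>l<k. t l = s" by blast
  qed auto
  ultimately show "multiform k I f (\<lambda>l. A l (h (t l))) = (if \<exists>s. \<forall>l<k. t l = s then 1 else 0)"
    by simp
qed

text \<open>The dimension bound makes \<open>Greatest\<close> meaningful, and r = 0 is admissible
  vacuously. Other finite label sets are enumerated by an initial segment of the naturals.\<close>

lemma
  assumes "k \<ge> 2" "finite I"
  shows subrank_attained: "\<exists>A. unit_restriction k I f {..<subrank k I f} A"
    and le_subrank: "finite T \<Longrightarrow> unit_restriction k I f T A \<Longrightarrow> card T \<le> subrank k I f"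
    and symmetric_subrank_attained:
      "\<exists>B. unit_restriction k I f {..<symmetric_subrank k I f} (\<lambda>_. B)"
    and le_symmetric_subrank:
      "finite T \<Longrightarrow> unit_restriction k I f T (\<lambda>_. B) \<Longrightarrow> card T \<le> symmetric_subrank k I f"
proof -
  let ?P = "\<lambda>r. \<exists>A. unit_restriction k I f {..<r} A"
  let ?Q = "\<lambda>r. \<exists>B. unit_restriction k I f {..<r} (\<lambda>_. B)"
  have eq: "subrank k I f = Greatest ?P" "symmetric_subrank k I f = Greatest ?Q"
    using assms(1) by (simp_all add: subrank_def symmetric_subrank_def unit_tensor_eq_apply_maps_iff)
  have bound: "r \<le> card I" if "?P r" for r
    using that unit_restriction_card_le[OF _ assms, of f "{..<r}"] by auto
  have bound': "r \<le> card I" if "?Q r" for r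
    using that bound by blast
  have empty: "{..<k} \<rightarrow> ({} :: nat set) = {}"
    using assms(1) by (auto intro!: exI[of _ 0])
  have zero: "unit_restriction k I f {..<0::nat} A" for A
    using assms(1) by (simp add: unit_restriction_def empty)
  have index: "\<exists>h. inj_on h {..<card T} \<and> h ` {..<card T} \<subseteq> T" if "finite T" for T :: "'t set"
    using ex_bij_betw_nat_finite[OF that] by (auto simp: bij_betw_def lessThan_atLeast0)
  show "?P (subrank k I f)"
    unfolding eq using zero by (rule_tac GreatestI_nat[of ?P 0 "card I"]) (auto intro: bound)
  show "?Q (symmetric_subrank k I f)"
    unfolding eq using zero by (rule_tac GreatestI_nat[of ?Q 0 "card I"]) (auto intro: bound')
  show "card T \<le> subrank k I f" if "finite T" "unit_restriction k I f T A"
    using index[OF that(1)] unit_restriction_reindex[OF that(2)] unfolding eq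
    by (intro Greatest_le_nat[of ?P _ "card I"] bound) auto
  show "card T \<le> symmetric_subrank k I f" if "finite T" "unit_restriction k I f T (\<lambda>_. B)"
    using index[OF that(1)] unit_restriction_reindex[OF that(2)] unfolding eq
    by (intro Greatest_le_nat[of ?Q _ "card I"] bound') auto
qed

lemma subrank_le_card:
  assumes "k \<ge> 2" "finite I"
  shows "subrank k I f \<le> card I"
  using subrank_attained[OF assms, of f] unit_restriction_card_le[OF _ assms] by force

lemma symmetric_subrank_le_subrank:
  assumes "k \<ge> 2" "finite I"
  shows "symmetric_subrank k I f \<le> subrank k I f"
  using symmetric_subrank_attained[OF assms, of f] le_subrank[OF assms, of "{..<symmetric_subrank k I f}"]
  by force

section \<open>Products and powers of unit restrictions, and symmetrization\<close>

lemma unit_restriction_kron: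
  assumes "unit_restriction k (multi_indices n I) (kronecker_power k I f n) T A"
    and "unit_restriction k (multi_indices m I) (kronecker_power k I f m) T' B"
  shows "unit_restriction k (multi_indices (n + m) I) (kronecker_power k I f (n + m)) (T \<times> T')
    (\<lambda>l p. kron_vec n m (A l (fst p)) (B l (snd p)))"
  unfolding unit_restriction_def
proof
  fix t assume t: "t \<in> {..<k} \<rightarrow> T \<times> T'"
  have "kron_form k I f n (\<lambda>l. A l (fst (t l))) = (if \<exists>s. \<forall>l<k. fst (t l) = s then 1 else 0)"
    using t by (intro unit_restrictionD[OF assms(1)]) (auto simp: Pi_iff mem_Times_iff)
  moreover have "kron_form k I f m (\<lambda>l. B l (snd (t l))) = (if \<exists>s. \<forall>l<k. snd (t l) = s then 1 else 0)"
    using t by (intro unit_restrictionD[OF assms(2)]) (auto simp: Pi_iff mem_Times_iff)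
  moreover have "(\<exists>p. \<forall>l<k. t l = p) \<longleftrightarrow>
      (\<exists>s. \<forall>l<k. fst (t l) = s) \<and> (\<exists>s. \<forall>l<k. snd (t l) = s)"
    by (auto simp: prod_eq_iff)
  ultimately show "kron_form k I f (n + m) (\<lambda>l. kron_vec n m (A l (fst (t l))) (B l (snd (t l)))) =
      (if \<exists>s. \<forall>l<k. t l = s then 1 else 0)"
    by (simp add: kron_form_kron_vec)
qed

text \<open>A subset of \<open>{..<M}\<close> is a string of M bits, one for each tensor factor.
  This yields size 2^M, with the labels that index the polarization identity when M = k.\<close>

lemma unit_restriction_power_Pow:
  assumes "unit_restriction k (multi_indices n I) (kronecker_power k I f n) UNIV (\<lambda>_. b)"
  shows "unit_restriction k (multi_indices (M * n) I) (kronecker_power k I f (M * n)) (Pow {..<M})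
    (\<lambda>_ S. kron_power_vec n M (\<lambda>t. b (t \<in> S)))"
  unfolding unit_restriction_def
proof
  fix S :: "nat \<Rightarrow> nat set" assume S: "S \<in> {..<k} \<rightarrow> Pow {..<M}"
  have "kron_form k I f (M * n) (\<lambda>l. kron_power_vec n M (\<lambda>t. b (t \<in> S l))) =
      (\<Prod>t<M. if \<exists>s. \<forall>l<k. (t \<in> S l) = s then 1 else 0)"
    by (simp add: kron_form_power unit_restrictionD[OF assms])
  also have "\<dots> = (if \<forall>t<M. \<exists>s. \<forall>l<k. (t \<in> S l) = s then 1 else 0)"
    by (auto intro: prod_zero)
  also have "(\<forall>t<M. \<exists>s. \<forall>l<k. (t \<in> S l) = s) \<longleftrightarrow> (\<exists>s. \<forall>l<k. S l = s)"
  proof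
    assume const: "\<forall>t<M. \<exists>s. \<forall>l<k. (t \<in> S l) = s"
    have "S l = S 0" if "l < k" for l
    proof -
      have "S l \<subseteq> {..<M}" "S 0 \<subseteq> {..<M}" "0 < k"
        using S that by auto
      then show ?thesis
        using const that by (intro set_eqI) (metis lessThan_iff subsetD)
    qed
    then show "\<exists>s. \<forall>l<k. S l = s" by (intro exI[of _ "S 0"] allI impI)
  next
    assume "\<exists>s. \<forall>l<k. S l = s"
    then obtain s where "\<And>l. l < k \<Longrightarrow> S l = s" by blast
    then show "\<forall>t<M. \<exists>s. \<forall>l<k. (t \<in> S l) = s" by auto
  qed
  finally show "kron_form k I f (M * n) (\<lambda>l. kron_power_vec n M (\<lambda>t. b (t \<in> S l))) =
      (if \<exists>s. \<forall>l<k. S l = s then 1 else 0)" .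
qed

text \<open>The unit tensor inside the m-th power acts as a switch: it annihilates all cross terms
  in which the legs choose different sets \<open>S\<close>. What remains of the form at the sums
  \<open>C\<close> is the polarization sum for the rows of \<open>A\<close>.\<close>

lemma symmetric_unit_restriction_kron:
  fixes f :: "(nat \<Rightarrow> 'i) \<Rightarrow> 'a::alg_closed_field"
  assumes sym: "symmetric_tensor k I f" and k: "k > 0" and fact: "of_nat (fact k) \<noteq> (0::'a)"
    and A: "unit_restriction k (multi_indices n I) (kronecker_power k I f n) T A"
    and B: "unit_restriction k (multi_indices m I) (kronecker_power k I f m) (Pow {..<k}) (\<lambda>_. B)"
  shows "\<exists>C. unit_restriction k (multi_indices (n + m) I) (kronecker_power k I f (n + m)) T (\<lambda>_. C)"
proof -
  \<comment> \<open>The coefficient of \<open>S\<close> in the polarization sum, divided by k!, is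
    spread evenly over the legs by a k-th root, because every leg uses the same map.\<close>
  have "\<exists>z::'a. z ^ k = (-1) ^ card ({..<k} - S) / of_nat (fact k)" for S
    using k nth_root_exists by blast
  then obtain \<eta> :: "nat set \<Rightarrow> 'a"
    where \<eta>: "\<And>S. \<eta> S ^ k = (-1) ^ card ({..<k} - S) / of_nat (fact k)"
    by metis
  \<comment> \<open>The rows labelled \<open>i\<close> of all legs in \<open>S\<close> are added up
    and tagged with the switch vector \<open>B S\<close>.\<close>
  define D where "D S i = kron_vec n m (\<lambda>J. \<Sum>s\<in>S. A s i J) (B S)" for S i
  define C where "C i = (\<lambda>J. \<Sum>S\<in>Pow {..<k}. \<eta> S * D S i J)" for i
  have "kron_form k I f (n + m) (\<lambda>l. C (i l)) = (if \<exists>s. \<forall>l<k. i l = s then 1 else 0)"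
    if i: "i \<in> {..<k} \<rightarrow> T" for i
  proof -
    let ?E = "{..<k} \<rightarrow>\<^sub>E Pow {..<k}"
    let ?F = "\<lambda>t. (\<Prod>l<k. \<eta> (t l)) * kron_form k I f n (\<lambda>l J. \<Sum>s\<in>t l. A s (i l) J)"
    have "kron_form k I f (n + m) (\<lambda>l. C (i l)) =
        (\<Sum>t\<in>?E. kron_form k I f (n + m) (\<lambda>l J. \<eta> (t l) * D (t l) (i l) J))"
      unfolding C_def by (subst multiform_sum) simp_all
    also have "\<dots> = (\<Sum>t\<in>?E. ?F t * (if \<exists>s. \<forall>l<k. t l = s then 1 else 0))"
    proof (rule sum.cong[OF refl])
      fix t assume "t \<in> ?E"
      then have "kron_form k I f m (\<lambda>l. B (t l)) = (if \<exists>s. \<forall>l<k. t l = s then 1 else 0)"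
        by (intro unit_restrictionD[OF B]) auto
      then show "kron_form k I f (n + m) (\<lambda>l J. \<eta> (t l) * D (t l) (i l) J) =
          ?F t * (if \<exists>s. \<forall>l<k. t l = s then 1 else 0)"
        unfolding D_def by (subst multiform_scale, subst kron_form_kron_vec) (simp add: mult.assoc)
    qed
    also have "\<dots> = (\<Sum>t\<in>(\<lambda>S. \<lambda>l\<in>{..<k}. S) ` Pow {..<k}. ?F t)"
    proof (rule sum.mono_neutral_cong_right)
      show "\<forall>t\<in>?E - (\<lambda>S. \<lambda>l\<in>{..<k}. S) ` Pow {..<k}.
          ?F t * (if \<exists>s. \<forall>l<k. t l = s then 1 else 0) = 0"
      proof
        fix t assume t: "t \<in> ?E - (\<lambda>S. \<lambda>l\<in>{..<k}. S) ` Pow {..<k}"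
        have "\<not> (\<exists>s. \<forall>l<k. t l = s)"
        proof
          assume "\<exists>s. \<forall>l<k. t l = s"
          then obtain s where s: "\<And>l. l < k \<Longrightarrow> t l = s" by blast
          have "t = (\<lambda>l\<in>{..<k}. s)"
            using t s by (auto simp: PiE_iff extensional_def restrict_def fun_eq_iff)
          moreover have "s \<in> Pow {..<k}"
            using t s[OF k] k by (auto simp: PiE_iff)
          ultimately show False using t by blast
        qed
        then show "?F t * (if \<exists>s. \<forall>l<k. t l = s then 1 else 0) = 0" by (simp only: if_False mult_zero_right)
      qed
    qed (auto simp: finite_PiE)
    also have "\<dots> = (\<Sum>S\<in>Pow {..<k}. ?F (\<lambda>l\<in>{..<k}. S))"
      using k by (subst sum.reindex) (auto intro!: inj_onI dest!: fun_cong[of _ _ 0])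
    also have "\<dots> = (\<Sum>S\<in>Pow {..<k}. (-1) ^ card ({..<k} - S) / of_nat (fact k) *
        kron_form k I f n (\<lambda>l J. \<Sum>s\<in>S. A s (i l) J))"
    proof (rule sum.cong[OF refl])
      fix S
      have "kron_form k I f n (\<lambda>l J. \<Sum>s\<in>(\<lambda>l\<in>{..<k}. S) l. A s (i l) J) =
          kron_form k I f n (\<lambda>l J. \<Sum>s\<in>S. A s (i l) J)"
        by (rule multiform_cong) simp
      then show "?F (\<lambda>l\<in>{..<k}. S) = (-1) ^ card ({..<k} - S) / of_nat (fact k) *
          kron_form k I f n (\<lambda>l J. \<Sum>s\<in>S. A s (i l) J)"
        by (simp add: \<eta>)
    qed
    also have "\<dots> = (\<Sum>S\<in>Pow {..<k}. (-1) ^ card ({..<k} - S) *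
        kron_form k I f n (\<lambda>l J. \<Sum>s\<in>S. A s (i l) J)) / of_nat (fact k)"
      by (simp add: sum_divide_distrib)
    also have "\<dots> = (\<Sum>\<sigma> | \<sigma> permutes {..<k}. kron_form k I f n (\<lambda>l. A (\<sigma> l) (i l))) / of_nat (fact k)"
      by (subst polarization) simp
    \<comment> \<open>Permuting the legs of \<open>A\<close> amounts to permuting the label tuple
      \<open>i\<close>, which does not affect whether \<open>i\<close> is constant. So all k! terms
      agree and cancel the factor 1/k!.\<close>
    also have "(\<Sum>\<sigma> | \<sigma> permutes {..<k}. kron_form k I f n (\<lambda>l. A (\<sigma> l) (i l))) =
        (\<Sum>\<sigma> | \<sigma> permutes {..<k}. if \<exists>s. \<forall>l<k. i l = s then 1 else 0)"
    proof (rule sum.cong[OF refl])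
      fix \<sigma> assume "\<sigma> \<in> {\<sigma>. \<sigma> permutes {..<k}}"
      then have \<sigma>: "\<sigma> permutes {..<k}" by simp
      have inv: "inv \<sigma> l < k \<longleftrightarrow> l < k" for l
        using permutes_in_image[OF permutes_inv[OF \<sigma>]] by simp
      have "kron_form k I f n (\<lambda>l. A (\<sigma> l) (i l)) = kron_form k I f n (\<lambda>l. A l (i (inv \<sigma> l)))"
        using multiform_permute[OF symmetric_kronecker_power[OF sym] \<sigma>, of n "\<lambda>l. A l (i (inv \<sigma> l))"]
          permutes_inverses(2)[OF \<sigma>] by simp
      also have "\<dots> = (if \<exists>s. \<forall>l<k. i (inv \<sigma> l) = s then 1 else 0)"
        using i inv by (intro unit_restrictionD[OF A]) auto
      also have "(\<exists>s. \<forall>l<k. i (inv \<sigma> l) = s) \<longleftrightarrow> (\<exists>s. \<forall>l<k. i l = s)"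
        using inv permutes_inverses(2)[OF \<sigma>] permutes_in_image[OF \<sigma>] by (metis lessThan_iff)
      finally show "kron_form k I f n (\<lambda>l. A (\<sigma> l) (i l)) = (if \<exists>s. \<forall>l<k. i l = s then 1 else 0)" .
    qed
    also have "\<dots> / of_nat (fact k) = (if \<exists>s. \<forall>l<k. i l = s then 1 else 0 :: 'a)"
      using fact by (simp add: card_permutations)
    finally show ?thesis .
  qed
  then show ?thesis
    unfolding unit_restriction_def by blast
qed

section \<open>Symmetric unit tensors in powers\<close>

lemma multiform_add:
  "multiform k I f (\<lambda>l i. u l i + v l i) =
    (\<Sum>S\<in>Pow {..<k}. multiform k I f (\<lambda>l. if l \<in> S then u l else v l))"
proof -
  have "(\<Prod>l<k. u l (j l) + v l (j l)) =
      (\<Sum>S\<in>Pow {..<k}. \<Prod>l<k. (if l \<in> S then u l else v l) (j l))" for j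
  proof -
    have "(\<Prod>l<k. (if l \<in> S then u l else v l) (j l)) =
        (\<Prod>l\<in>S. u l (j l)) * (\<Prod>l\<in>{..<k} - S. v l (j l))" if "S \<in> Pow {..<k}" for S
    proof -
      have "(\<Prod>l<k. (if l \<in> S then u l else v l) (j l)) =
          (\<Prod>l<k. if l \<in> S then u l (j l) else v l (j l))"
        by (intro prod.cong) auto
      moreover have "{..<k} \<inter> {l. l \<in> S} = S" "{..<k} \<inter> - {l. l \<in> S} = {..<k} - S"
        using that by auto
      ultimately show ?thesis
        by (simp add: prod.If_cases)
    qed
    then show ?thesis
      by (subst prod_add) auto
  qed
  then show ?thesis
    unfolding multiform_def by (simp add: sum_distrib_right sum.swap[of _ "Pow {..<k}"])
qed

text \<open>By symmetry only the number of arguments equal to \<open>u\<close> matters: bijections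
  of \<open>S\<close> and of its complement onto the two segments glue to a permutation.\<close>

lemma multiform_initial_segment:
  assumes "symmetric_tensor k I f" "S \<subseteq> {..<k}"
  shows "multiform k I f (\<lambda>l. if l \<in> S then u else v) = multiform k I f (\<lambda>l. if l < card S then u else v)"
proof -
  have fin: "finite S" and le: "card S \<le> k"
    using assms(2) card_mono[OF _ assms(2)] by (auto intro: finite_subset)
  obtain g where g: "bij_betw g S {..<card S}"
    using ex_bij_betw_finite_nat[OF fin] by (auto simp: lessThan_atLeast0)
  have "card ({..<k} - S) = card {card S..<k}"
    using assms(2) fin by (simp add: card_Diff_subset)
  then obtain h where h: "bij_betw h ({..<k} - S) {card S..<k}"
    using finite_same_card_bij by (metis finite_Diff finite_atLeastLessThan finite_lessThan)
  define \<sigma> where "\<sigma> l = (if l \<in> S then g l else if l < k then h l else l)" for l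
  have "bij_betw \<sigma> S {..<card S}"
    using g by (subst bij_betw_cong[of _ _ g]) (auto simp: \<sigma>_def)
  moreover have "bij_betw \<sigma> ({..<k} - S) {card S..<k}"
    using h by (subst bij_betw_cong[of _ _ h]) (auto simp: \<sigma>_def)
  ultimately have "bij_betw \<sigma> (S \<union> ({..<k} - S)) ({..<card S} \<union> {card S..<k})"
    by (rule bij_betw_combine) auto
  moreover have "S \<union> ({..<k} - S) = {..<k}" "{..<card S} \<union> {card S..<k} = {..<k}"
    using assms(2) le by auto
  ultimately have "\<sigma> permutes {..<k}"
    using assms(2) by (intro bij_imp_permutes) (auto simp: \<sigma>_def)
  then have "multiform k I f (\<lambda>l. if l < card S then u else v) =
      multiform k I f (\<lambda>l. if \<sigma> l < card S then u else v)"
    by (rule multiform_permute[OF assms(1), symmetric])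
  also have "\<dots> = multiform k I f (\<lambda>l. if l \<in> S then u else v)"
  proof (rule multiform_cong)
    fix l i assume "l < k"
    then have "\<sigma> l < card S \<longleftrightarrow> l \<in> S"
      using bij_betw_apply[OF g, of l] bij_betw_apply[OF h, of l] by (auto simp: \<sigma>_def)
    then show "(if \<sigma> l < card S then u else v) i = (if l \<in> S then u else v) i" by simp
  qed
  finally show ?thesis by simp
qed

text \<open>A binary form has a nontrivial zero over an algebraically closed field: either
  \<open>u\<close> is one, or the value at x u + v is a polynomial in x of degree k > 0 whose
  leading coefficient is the value at \<open>u\<close>.\<close>

lemma multiform_root:
  fixes f :: "(nat \<Rightarrow> 'i) \<Rightarrow> 'a::alg_closed_field"
  assumes "k > 0"
  shows "\<exists>\<alpha> \<beta>. (\<alpha> \<noteq> 0 \<or> \<beta> \<noteq> 0) \<and> multiform k I f (\<lambda>_ i. \<alpha> * u i + \<beta> * v i) = 0"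
proof (cases "multiform k I f (\<lambda>_. u) = 0")
  case True
  then show ?thesis by (intro exI[of _ 1] exI[of _ 0]) simp
next
  case False
  define c where "c n = (\<Sum>S | S \<in> Pow {..<k} \<and> card S = n. multiform k I f (\<lambda>l. if l \<in> S then u else v))" for n
  have poly: "multiform k I f (\<lambda>_ i. x * u i + v i) = (\<Sum>n\<le>k. c n * x ^ n)" for x
  proof -
    have monomial: "multiform k I f (\<lambda>l. if l \<in> S then \<lambda>i. x * u i else v) =
        x ^ card S * multiform k I f (\<lambda>l. if l \<in> S then u else v)" if "S \<in> Pow {..<k}" for S
    proof -
      have "{..<k} \<inter> {l. l \<in> S} = S" using that by auto
      then have "(\<Prod>l<k. if l \<in> S then x else 1) = x ^ card S"
        by (simp add: prod.If_cases)
      moreover have "(\<lambda>l. if l \<in> S then \<lambda>i. x * u i else v) =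
          (\<lambda>l i. (if l \<in> S then x else 1) * (if l \<in> S then u else v) i)"
        by (auto simp: fun_eq_iff)
      ultimately show ?thesis
        by (simp only: multiform_scale)
    qed
    have "card S \<le> k" if "S \<in> Pow {..<k}" for S
      using card_mono[of "{..<k}" S] that by simp
    then have "card ` Pow {..<k} \<subseteq> {..k}"
      by auto
    then have "(\<Sum>S\<in>Pow {..<k}. x ^ card S * multiform k I f (\<lambda>l. if l \<in> S then u else v)) =
        (\<Sum>n\<le>k. \<Sum>S | S \<in> Pow {..<k} \<and> card S = n. x ^ card S * multiform k I f (\<lambda>l. if l \<in> S then u else v))"
      by (intro sum.group[symmetric]) auto
    also have "\<dots> = (\<Sum>n\<le>k. c n * x ^ n)"
      unfolding c_def sum_distrib_right by (intro sum.cong refl) (simp add: mult.commute)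
    finally have "(\<Sum>S\<in>Pow {..<k}. x ^ card S * multiform k I f (\<lambda>l. if l \<in> S then u else v)) =
        (\<Sum>n\<le>k. c n * x ^ n)" .
    then show ?thesis
      by (simp add: multiform_add monomial)
  qed
  have "{S. S \<in> Pow {..<k} \<and> card S = k} = {{..<k}}"
    using card_subset_eq[of "{..<k}"] by auto
  then have "c k = multiform k I f (\<lambda>l. if l \<in> {..<k} then u else v)"
    unfolding c_def by simp
  also have "\<dots> = multiform k I f (\<lambda>_. u)"
    by (rule multiform_cong) simp
  finally obtain x where "(\<Sum>n\<le>k. c n * x ^ n) = 0"
    using alg_closed[of k c] False assms by auto
  then show ?thesis
    by (intro exI[of _ x] exI[of _ 1]) (simp add: poly)
qed

text \<open>
  The associated homogeneous polynomial \<open>F(u) = f(u, \<dots>, u)\<close> is not a \<open>k\<close>-th power of a linear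
  form: the zero \<open>v\<close> of \<open>F\<close> lies in the span of two rows of the first leg, so that \<open>f(v, \<dots>)\<close> does
  not vanish identically, and \<open>F\<close> is not invariant under translation by \<open>v\<close>.
\<close>
lemma unit_restriction_exists_mixed:
  fixes f :: "(nat \<Rightarrow> 'i) \<Rightarrow> 'a::alg_closed_field"
  assumes sym: "symmetric_tensor k I f" and k: "k \<ge> 2" and fact: "of_nat (fact k) \<noteq> (0::'a)"
    and A: "unit_restriction k I f (UNIV :: bool set) A"
  shows "\<exists>u v p. 0 < p \<and> p < k \<and> (\<forall>j<p. multiform k I f (\<lambda>l. if l < j then u else v) = 0) \<and>
    multiform k I f (\<lambda>l. if l < p then u else v) \<noteq> 0"
proof -
  have "k > 0" using k by simp
  obtain \<alpha> \<beta> where \<alpha>\<beta>: "\<alpha> \<noteq> 0 \<or> \<beta> \<noteq> 0"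
    and root: "multiform k I f (\<lambda>_ i. \<alpha> * A 0 True i + \<beta> * A 0 False i) = 0"
    using multiform_root[OF \<open>k > 0\<close>, of I f "A 0 True" "A 0 False"] by blast
  define v where "v = (\<lambda>i. \<alpha> * A 0 True i + \<beta> * A 0 False i)"
  \<comment> \<open>Pairing \<open>v\<close> in leg 0 with the rows labelled \<open>s\<close> in the
    other legs reads off the coefficient of \<open>A 0 s\<close> in \<open>v\<close>.\<close>
  have val: "multiform k I f (\<lambda>l. if l = 0 then v else A l s) = (if s then \<alpha> else \<beta>)" for s
  proof -
    let ?x = "\<lambda>l. A l s"
    have unit: "multiform k I f (?x(0 := A 0 s')) = (if s = s' then 1 else 0)" for s'
    proof -
      have "multiform k I f (?x(0 := A 0 s')) = multiform k I f (\<lambda>l. A l (if l = 0 then s' else s))"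
        by (rule multiform_cong) simp
      also have "\<dots> = (if \<exists>t. \<forall>l<k. (if l = 0 then s' else s) = t then 1 else 0)"
        by (rule unit_restrictionD[OF A]) simp
      also have "(\<exists>t. \<forall>l<k. (if l = 0 then s' else s) = t) \<longleftrightarrow> s = s'"
      proof
        assume "\<exists>t. \<forall>l<k. (if l = 0 then s' else s) = t"
        then obtain t where t: "\<And>l. l < k \<Longrightarrow> (if l = 0 then s' else s) = t" by blast
        show "s = s'" using t[of 0] t[of 1] k by simp
      qed auto
      finally show ?thesis .
    qed
    have "multiform k I f (\<lambda>l. if l = 0 then v else A l s) =
        multiform k I f (?x(0 := \<lambda>i. \<Sum>s'\<in>UNIV. (if s' then \<alpha> else \<beta>) * A 0 s' i))"
      by (rule multiform_cong) (simp add: v_def UNIV_bool)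
    also have "\<dots> = (if s then \<alpha> else \<beta>)"
      by (subst multiform_sum_first[OF \<open>k > 0\<close>]) (simp add: unit UNIV_bool)
    finally show ?thesis .
  qed
  \<comment> \<open>This choice selects a label whose coefficient in \<open>v\<close> is
    nonzero.\<close>
  define s where "s \<longleftrightarrow> \<alpha> \<noteq> 0"
  define x where "x l = (if l = 0 then v else A l s)" for l
  have x: "multiform k I f x \<noteq> 0"
    using val[of s] \<alpha>\<beta> unfolding x_def s_def by (auto split: if_splits)
  \<comment> \<open>If translation by \<open>v\<close> never changed the diagonal values, the
    polarization terms of \<open>S\<close> and \<open>insert 0 S\<close>, whose arguments differ by
    x 0 = v, would cancel in pairs, and the form would vanish at \<open>x\<close>.\<close>
  have "\<exists>u. multiform k I f (\<lambda>_ i. u i + v i) \<noteq> multiform k I f (\<lambda>_. u)"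
  proof (rule ccontr)
    assume "\<not> ?thesis"
    then have shift: "multiform k I f (\<lambda>_ i. u i + v i) = multiform k I f (\<lambda>_. u)" for u
      by blast
    let ?g = "\<lambda>S. (-1) ^ card ({..<k} - S) * multiform k I f (\<lambda>_ i. \<Sum>s\<in>S. x s i)"
    have Pow: "Pow {..<k} = Pow {1..<k} \<union> insert 0 ` Pow {1..<k}"
    proof -
      have "{..<k} = insert 0 {1..<k}"
        using \<open>k > 0\<close> by auto
      then show ?thesis
        by (simp only: Pow_insert)
    qed
    have "inj_on (insert 0) (Pow {1..<k})"
      by (rule inj_onI) (subst (asm) insert_ident, auto)
    then have "(\<Sum>S\<in>Pow {..<k}. ?g S) = (\<Sum>S\<in>Pow {1..<k}. ?g S) + (\<Sum>S\<in>Pow {1..<k}. ?g (insert 0 S))"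
      unfolding Pow by (subst sum.union_disjoint) (auto simp: sum.reindex)
    also have "(\<Sum>S\<in>Pow {1..<k}. ?g (insert 0 S)) = (\<Sum>S\<in>Pow {1..<k}. - ?g S)"
    proof (rule sum.cong[OF refl])
      fix S assume S: "S \<in> Pow {1..<k}"
      then have fin: "finite S" and "0 \<notin> S"
        by (auto intro: finite_subset)
      then have "(\<lambda>_::nat. \<lambda>i. \<Sum>s\<in>insert 0 S. x s i) = (\<lambda>_ i. (\<Sum>s\<in>S. x s i) + v i)"
        by (simp add: x_def add.commute)
      then have "multiform k I f (\<lambda>_ i. \<Sum>s\<in>insert 0 S. x s i) = multiform k I f (\<lambda>_ i. \<Sum>s\<in>S. x s i)"
        using shift[of "\<lambda>i. \<Sum>s\<in>S. x s i"] by simp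
      moreover have "card ({..<k} - S) = Suc (card ({..<k} - insert 0 S))"
        using \<open>0 \<notin> S\<close> \<open>k > 0\<close> by (metis Diff_insert card_Suc_Diff1 DiffI finite_Diff finite_lessThan lessThan_iff)
      ultimately show "?g (insert 0 S) = - ?g S" by simp
    qed
    finally have "of_nat (fact k) * multiform k I f x = 0"
      using polarization_symmetric[OF sym, of x] by (simp add: sum_negf)
    then show False
      using x fact by simp
  qed
  then obtain u where u: "multiform k I f (\<lambda>_ i. u i + v i) \<noteq> multiform k I f (\<lambda>_. u)" by blast
  let ?c = "\<lambda>j. multiform k I f (\<lambda>l. if l < j then u else v)"
  have c0: "?c 0 = 0"
    using root by (simp add: v_def)
  have "\<exists>p<k. ?c p \<noteq> 0"
  proof (rule ccontr)
    \<comment> \<open>Expanding the diagonal value at u + v would then leave only the term with k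
      copies of \<open>u\<close>, against the choice of \<open>u\<close>.\<close>
    assume *: "\<not> ?thesis"
    have zero: "multiform k I f (\<lambda>l. if l \<in> S then u else v) = 0" if "S \<in> Pow {..<k} - {{..<k}}" for S
    proof -
      have "S \<subset> {..<k}" using that by blast
      then have "card S < k" using psubset_card_mono[of "{..<k}" S] by simp
      then show ?thesis
        using * that multiform_initial_segment[OF sym, of S u v] by auto
    qed
    have "multiform k I f (\<lambda>_ i. u i + v i) =
        (\<Sum>S\<in>{{..<k}}. multiform k I f (\<lambda>l. if l \<in> S then u else v))"
      unfolding multiform_add using zero by (intro sum.mono_neutral_right) auto
    also have "\<dots> = multiform k I f (\<lambda>l. if l \<in> {..<k} then u else v)"
      by simp
    also have "\<dots> = multiform k I f (\<lambda>_. u)"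
      by (rule multiform_cong) simp
    finally show False using u by simp
  qed
  then obtain q where q: "q < k" "?c q \<noteq> 0" by blast
  define p where "p = (LEAST p. ?c p \<noteq> 0)"
  have "?c p \<noteq> 0" "p \<le> q" "\<And>j. j < p \<Longrightarrow> ?c j = 0"
    using LeastI[of "\<lambda>p. ?c p \<noteq> 0" q] Least_le[of "\<lambda>p. ?c p \<noteq> 0" q] not_less_Least[of _ "\<lambda>p. ?c p \<noteq> 0"] q
    unfolding p_def by blast+
  moreover have "p \<noteq> 0" using \<open>?c p \<noteq> 0\<close> c0 by metis
  ultimately show ?thesis
    using q(1) by (intro exI[of _ u] exI[of _ v] exI[of _ p]) auto
qed

section \<open>Incidence counts and a symmetric unit tensor of size two\<close>

text \<open>
  Averaging over all \<open>p\<close>-element subsets forces equality everywhere, and exchanging one element of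
  such a subset shows that the weights are constant. As the total weight is \<open>k\<close>, one of the
  constants is \<open>1\<close> and the other is \<open>0\<close>.
\<close>
lemma constant_weights:
  fixes N N' :: "nat \<Rightarrow> nat"
  assumes p: "0 < p" "p < k"
    and X: "X = {S. S \<subseteq> {..<k} \<and> card S = p}"
    and total: "(\<Sum>s<k. N s) + (\<Sum>s<k. N' s) = k"
    and ge: "\<And>S S'. S \<in> X \<Longrightarrow> S' \<in> X \<Longrightarrow> p \<le> sum N S + sum N' S'"
  shows "(\<forall>s<k. N s = 1 \<and> N' s = 0) \<or> (\<forall>s<k. N s = 0 \<and> N' s = 1)"
proof -
  have fin: "finite X"
    unfolding X by (rule finite_subset[of _ "Pow {..<k}"]) auto
  \<comment> \<open>The number of p-subsets through a given point; summing weights over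
    \<open>X\<close> multiplies the total weight by it.\<close>
  define C where "C = (k - 1) choose (p - 1)"
  have card_X: "card X = k choose p"
    unfolding X by (simp add: n_subsets)
  have member: "card {S\<in>X. s \<in> S} = C" if "s < k" for s
  proof -
    have "bij_betw (insert s) {S. S \<subseteq> {..<k} - {s} \<and> card S = p - 1} {S\<in>X. s \<in> S}"
    proof (rule bij_betw_byWitness[where f' = "\<lambda>S. S - {s}"])
      show "insert s ` {S. S \<subseteq> {..<k} - {s} \<and> card S = p - 1} \<subseteq> {S \<in> X. s \<in> S}"
      proof clarify
        fix S assume S: "S \<subseteq> {..<k} - {s}" "card S = p - 1"
        then have "finite S" "s \<notin> S" by (auto intro: finite_subset)
        then show "insert s S \<in> X \<and> s \<in> insert s S"
          using S p that by (auto simp: X)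
      qed
      show "(\<lambda>S. S - {s}) ` {S \<in> X. s \<in> S} \<subseteq> {S. S \<subseteq> {..<k} - {s} \<and> card S = p - 1}"
        by (auto simp: X)
    qed auto
    then have "card {S\<in>X. s \<in> S} = card {S. S \<subseteq> {..<k} - {s} \<and> card S = p - 1}"
      by (simp add: bij_betw_same_card)
    also have "\<dots> = C"
      using that by (subst n_subsets) (simp_all add: C_def)
    finally show ?thesis .
  qed
  have average: "(\<Sum>S\<in>X. sum M S) = C * (\<Sum>s<k. M s)" for M :: "nat \<Rightarrow> nat"
  proof -
    have "(\<Sum>S\<in>X. sum M S) = (\<Sum>S\<in>X. \<Sum>s<k. if s \<in> S then M s else 0)"
      by (intro sum.cong refl sum.mono_neutral_cong_left) (auto simp: X)
    also have "\<dots> = (\<Sum>s<k. \<Sum>S\<in>X. if s \<in> S then M s else 0)"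
      by (rule sum.swap)
    also have "\<dots> = (\<Sum>s<k. \<Sum>S | S \<in> X \<and> s \<in> S. M s)"
      by (rule sum.cong[OF refl]) (simp only: sum.inter_filter[OF fin])
    finally show ?thesis
      by (simp add: member sum_distrib_left)
  qed
  have kC: "k * C = p * card X"
    using times_binomial_minus1_eq[OF p(1), of k] by (simp add: C_def card_X)
  have "(\<Sum>(S, S')\<in>X \<times> X. sum N S + sum N' S') = (\<Sum>(S, S')\<in>X \<times> X. p)"
  proof -
    have "(\<Sum>(S, S')\<in>X \<times> X. sum N S + sum N' S') = card X * (C * (\<Sum>s<k. N s) + C * (\<Sum>s<k. N' s))"
      by (simp add: sum.cartesian_product[symmetric] sum.distrib average sum_distrib_left[symmetric] distrib_left)
    also have "\<dots> = card X * (k * C)"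
      using total by (metis distrib_left mult.commute)
    finally show ?thesis
      by (simp add: kC card_cartesian_product)
  qed
  then have eq: "sum N S + sum N' S' = p" if "S \<in> X" "S' \<in> X" for S S'
  proof -
    have "(case q of (S, S') \<Rightarrow> p) = (case q of (S, S') \<Rightarrow> sum N S + sum N' S')"
      if "q \<in> X \<times> X" for q
      using that \<open>(\<Sum>(S, S')\<in>X \<times> X. sum N S + sum N' S') = (\<Sum>(S, S')\<in>X \<times> X. p)\<close> ge fin
      by (intro sum_mono_inv[of "\<lambda>(S, S'). p" "X \<times> X"]) auto
    from this[of "(S, S')"] that show ?thesis by simp
  qed
  have exchange: "M s = M s'"
    if M: "\<And>S S'. S \<in> X \<Longrightarrow> S' \<in> X \<Longrightarrow> sum M S = sum M S'" and s: "s < k" "s' < k"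
    for M :: "nat \<Rightarrow> nat" and s s'
  proof (cases "s = s'")
    case False
    \<comment> \<open>Since p < k, there is room for p - 1 points that avoid both \<open>s\<close>
      and \<open>s'\<close>.\<close>
    then have "p - 1 \<le> card ({..<k} - {s, s'})"
      using p s by (subst card_Diff_subset) auto
    then obtain R where R: "R \<subseteq> {..<k} - {s, s'}" "card R = p - 1" "finite R"
      using obtain_subset_with_card_n by metis
    have "s \<notin> R" "s' \<notin> R" using R(1) by auto
    then have "insert s R \<in> X" "insert s' R \<in> X"
      using R s p by (auto simp: X)
    then have "sum M (insert s R) = sum M (insert s' R)"
      by (rule M)
    then show ?thesis
      using R(3) \<open>s \<notin> R\<close> \<open>s' \<notin> R\<close> by simp
  qed simp
  have "card X > 0"
    using p by (simp add: card_X)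
  then have "X \<noteq> {}"
    by (metis card.empty less_irrefl)
  then obtain S0 where S0: "S0 \<in> X" by blast
  have invariant: "sum N S = sum N S'" "sum N' S = sum N' S'" if "S \<in> X" "S' \<in> X" for S S'
    using eq[OF that(1) S0] eq[OF that(2) S0] eq[OF S0 that(1)] eq[OF S0 that(2)] by simp_all
  obtain a b where const: "\<And>s. s < k \<Longrightarrow> N s = a" "\<And>s. s < k \<Longrightarrow> N' s = b"
  proof (rule that)
    show "N s = N 0" "N' s = N' 0" if "s < k" for s
      using exchange[of N s 0, OF invariant(1) that] exchange[of N' s 0, OF invariant(2) that] p by simp_all
  qed
  then have "k * (a + b) = k * 1"
    using total by (simp add: distrib_left)
  then have "a + b = 1"
    using p by (subst (asm) mult_left_cancel) auto
  then show ?thesis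
    using const by (cases "a = 0") auto
qed

text \<open>Leg \<open>l\<close> carries the vector of kind \<open>\<beta> l\<close> with label
  \<open>s l\<close>, and the factor at (S, S') counts the legs showing \<open>u\<close>. If the
  product is nonzero, every count is at least p. The fibre sizes of \<open>s\<close> within each
  kind are then weights for \<open>constant_weights\<close>, so each label occurs once and only one
  kind occurs. Conversely, a bijection hits every p-subset exactly p times.\<close>

lemma prod_incidence:
  fixes c :: "nat \<Rightarrow> 'a::field" and \<beta> :: "nat \<Rightarrow> bool"
  assumes p: "0 < p" "p < k" and c: "\<And>j. j < p \<Longrightarrow> c j = 0"
    and X: "X = {S. S \<subseteq> {..<k} \<and> card S = p}"
    and s: "s \<in> {..<k} \<rightarrow> {..<k}"
  shows "(\<Prod>(S, S')\<in>X \<times> X. c (card {l. l < k \<and> (if \<beta> l then s l \<in> S else s l \<in> S')})) =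
    (if (\<exists>b. \<forall>l<k. \<beta> l = b) \<and> s ` {..<k} = {..<k} then c p ^ card (X \<times> X) else 0)"
    (is "?prod = _")
proof (cases "(\<exists>b. \<forall>l<k. \<beta> l = b) \<and> s ` {..<k} = {..<k}")
  case True
  then obtain b where b: "\<And>l. l < k \<Longrightarrow> \<beta> l = b" and surj: "s ` {..<k} = {..<k}" by blast
  then have inj: "inj_on s {..<k}" by (simp add: eq_card_imp_inj_on)
  have count: "card {l. l < k \<and> s l \<in> S} = p" if "S \<in> X" for S
  proof -
    have "S \<subseteq> s ` {..<k}"
      using surj that by (simp add: X)
    then have "s ` {l. l < k \<and> s l \<in> S} = S"
      by blast
    moreover have "inj_on s {l. l < k \<and> s l \<in> S}"
      using inj by (rule inj_on_subset) auto
    ultimately show ?thesis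
      using that card_image by (fastforce simp: X)
  qed
  have "card {l. l < k \<and> (if \<beta> l then s l \<in> S else s l \<in> S')} = p" if "S \<in> X" "S' \<in> X" for S S'
  proof -
    have "{l. l < k \<and> (if \<beta> l then s l \<in> S else s l \<in> S')} = {l. l < k \<and> s l \<in> (if b then S else S')}"
      using b by auto
    then show ?thesis
      using count[of "if b then S else S'"] that by simp
  qed
  then have "?prod = (\<Prod>(S, S')\<in>X \<times> X. c p)"
    by (intro prod.cong refl) (simp only: split_beta mem_Times_iff)
  then show ?thesis
    using True by simp
next
  case False
  define N where "N x = card {l. l < k \<and> \<beta> l \<and> s l = x}" for x
  define N' where "N' x = card {l. l < k \<and> \<not> \<beta> l \<and> s l = x}" for x
  have sum_fibres: "(\<Sum>x\<in>S. card {l. l < k \<and> P l \<and> s l = x}) = card {l. l < k \<and> P l \<and> s l \<in> S}"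
    if "finite S" for S P
  proof -
    have "card {l. l < k \<and> P l \<and> s l \<in> S} = card (\<Union>x\<in>S. {l. l < k \<and> P l \<and> s l = x})"
      by (rule arg_cong[of _ _ card]) auto
    also have "\<dots> = (\<Sum>x\<in>S. card {l. l < k \<and> P l \<and> s l = x})"
      using that by (intro card_UN_disjoint) auto
    finally show ?thesis ..
  qed
  have split: "card {l. l < k \<and> (if \<beta> l then s l \<in> S else s l \<in> S')} = sum N S + sum N' S'"
    if "finite S" "finite S'" for S S'
  proof -
    have "{l. l < k \<and> (if \<beta> l then s l \<in> S else s l \<in> S')} =
        {l. l < k \<and> \<beta> l \<and> s l \<in> S} \<union> {l. l < k \<and> \<not> \<beta> l \<and> s l \<in> S'}"
      by auto
    then show ?thesis
      unfolding N_def N'_def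
      using that by (simp add: sum_fibres card_Un_disjoint disjoint_iff)
  qed
  have "?prod = 0"
  proof (rule ccontr)
    assume nonzero: "?prod \<noteq> 0"
    have fin: "finite X"
      unfolding X by (rule finite_subset[of _ "Pow {..<k}"]) auto
    have "p \<le> sum N S + sum N' S'" if "S \<in> X" "S' \<in> X" for S S'
    proof -
      have fins: "finite S" "finite S'"
        using that by (auto simp: X intro: finite_subset[OF _ finite_lessThan])
      have "c (card {l. l < k \<and> (if \<beta> l then s l \<in> S else s l \<in> S')}) \<noteq> 0"
      proof
        assume "c (card {l. l < k \<and> (if \<beta> l then s l \<in> S else s l \<in> S')}) = 0"
        then have "\<exists>q\<in>X \<times> X. (case q of (S, S') \<Rightarrow>
            c (card {l. l < k \<and> (if \<beta> l then s l \<in> S else s l \<in> S')})) = 0"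
          using that by (intro bexI[of _ "(S, S')"]) (simp_all only: prod.case mem_Times_iff fst_conv snd_conv)
        then have "?prod = 0"
          using fin by (intro prod_zero) simp_all
        then show False
          using nonzero by contradiction
      qed
      then have "c (sum N S + sum N' S') \<noteq> 0"
        unfolding split[OF fins] .
      then show ?thesis
        using c not_le by blast
    qed
    moreover have "(\<Sum>x<k. N x) + (\<Sum>x<k. N' x) = k"
    proof -
      have "{l. l < k \<and> (if \<beta> l then s l \<in> {..<k} else s l \<in> {..<k})} = {..<k}"
        using s by auto
      then show ?thesis
        using split[of "{..<k}" "{..<k}"] by simp
    qed
    ultimately have N: "(\<forall>x<k. N x = 1 \<and> N' x = 0) \<or> (\<forall>x<k. N x = 0 \<and> N' x = 1)"
      using constant_weights[OF p X, of N N'] by blast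
    have less: "s l < k" if "l < k" for l
      using s that by auto
    have "{..<k} \<subseteq> s ` {..<k}"
    proof
      fix x assume "x \<in> {..<k}"
      then have "N x \<noteq> 0 \<or> N' x \<noteq> 0"
        using N by auto
      then have "{l. l < k \<and> \<beta> l \<and> s l = x} \<noteq> {} \<or> {l. l < k \<and> \<not> \<beta> l \<and> s l = x} \<noteq> {}"
        unfolding N_def N'_def by (metis card.empty)
      then show "x \<in> s ` {..<k}" by auto
    qed
    then have "s ` {..<k} = {..<k}"
      using s by auto
    moreover have "\<exists>b. \<forall>l<k. \<beta> l = b"
    proof -
      have pos: "N (s l) \<noteq> 0" if "l < k" "\<beta> l" for l
        unfolding N_def using that by (auto simp: card_eq_0_iff)
      have pos': "N' (s l) \<noteq> 0" if "l < k" "\<not> \<beta> l" for l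
        unfolding N'_def using that by (auto simp: card_eq_0_iff)
      from N show ?thesis
      proof
        assume "\<forall>x<k. N x = 1 \<and> N' x = 0"
        then have "\<forall>l<k. \<beta> l = True"
          using pos' less by blast
        then show ?thesis ..
      next
        assume "\<forall>x<k. N x = 0 \<and> N' x = 1"
        then have "\<forall>l<k. \<beta> l = False"
          using pos less by blast
        then show ?thesis ..
      qed
    qed
    ultimately show False
      using False by blast
  qed
  then show ?thesis
    unfolding if_not_P[OF False] .
qed

lemma card_surj_PiE:
  "card {t \<in> {..<k} \<rightarrow>\<^sub>E {..<k::nat}. t ` {..<k} = {..<k}} = fact k"
  using bij_betw_same_card[OF surj_PiE_permutes[of k]] by (simp add: card_permutations)

text \<open>
  Let \<open>c\<^sub>j\<close> be the value of the form on \<open>j\<close> copies of \<open>u\<close> and \<open>k - j\<close> copies of \<open>v\<close>. Index the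
  factors of the power by pairs \<open>(S, S')\<close> of \<open>p\<close>-subsets of \<open>{..<k}\<close>. For each \<open>s < k\<close> take the
  product vector with factor \<open>u\<close> where \<open>s \<in> S\<close> and \<open>v\<close> elsewhere, and likewise with \<open>s \<in> S'\<close>. As
  \<open>c\<^sub>j = 0\<close> for \<open>j < p\<close>, counting the factors \<open>u\<close> shows that only \<open>k\<close> distinct vectors of the same
  kind evaluate to something nonzero, so the sums of the two kinds give a scaled unit tensor.
\<close>
lemma mixed_imp_unit_restriction_power:
  fixes f :: "(nat \<Rightarrow> 'i) \<Rightarrow> 'a::alg_closed_field"
  assumes sym: "symmetric_tensor k I f" and fact: "of_nat (fact k) \<noteq> (0::'a)"
    and p: "0 < p" "p < k"
    and zero: "\<And>j. j < p \<Longrightarrow> kron_form k I f n (\<lambda>l. if l < j then u else v) = 0"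
    and nonzero: "kron_form k I f n (\<lambda>l. if l < p then u else v) \<noteq> 0"
  shows "\<exists>M b. unit_restriction k (multi_indices (M * n) I) (kronecker_power k I f (M * n))
    (UNIV :: bool set) (\<lambda>_. b)"
proof -
  define c where "c j = kron_form k I f n (\<lambda>l. if l < j then u else v)" for j
  define X where "X = {S. S \<subseteq> {..<k} \<and> card S = p}"
  define M where "M = card (X \<times> X)"
  have "finite X"
    unfolding X_def by (rule finite_subset[of _ "Pow {..<k}"]) auto
  then obtain h where h: "bij_betw h {..<M} (X \<times> X)"
    unfolding M_def by (metis ex_bij_betw_nat_finite finite_cartesian_product lessThan_atLeast0)
  have "of_nat (fact k) * c p ^ M \<noteq> 0"
    using fact nonzero by (simp add: c_def)
  \<comment> \<open>Each of the k! surjective label tuples will contribute \<open>c p ^ M\<close>,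
    and the k legs contribute \<open>\<rho> ^ k\<close>; this choice normalizes the total to
    1.\<close>
  obtain \<rho> where \<rho>: "\<rho> ^ k = inverse (of_nat (fact k) * c p ^ M)"
    using nth_root_exists[of k] p by (metis less_trans)
  define z where "z \<beta> s t = (if (if \<beta> then s \<in> fst (h t) else s \<in> snd (h t)) then u else v)"
    for \<beta> :: bool and s t
  define b where "b \<beta> = (\<lambda>J. \<Sum>s<k. \<rho> * kron_power_vec n M (z \<beta> s) J)" for \<beta>
  have "kron_form k I f (M * n) (\<lambda>l. b (\<beta> l)) = (if \<exists>s. \<forall>l<k. \<beta> l = s then 1 else 0)" for \<beta>
  proof -
    define const where "const \<longleftrightarrow> (\<exists>b. \<forall>l<k. \<beta> l = b)"
    let ?E = "{..<k} \<rightarrow>\<^sub>E {..<k}"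
    have eval: "kron_form k I f (M * n) (\<lambda>l. kron_power_vec n M (z (\<beta> l) (s l))) =
        (if const \<and> s ` {..<k} = {..<k} then c p ^ M else 0)" if s: "s \<in> ?E" for s
    proof -
      let ?L = "\<lambda>S S'. {l. l < k \<and> (if \<beta> l then s l \<in> S else s l \<in> S')}"
      have "kron_form k I f n (\<lambda>l. z (\<beta> l) (s l) t) = (case h t of (S, S') \<Rightarrow> c (card (?L S S')))" for t
      proof -
        have "kron_form k I f n (\<lambda>l. z (\<beta> l) (s l) t) =
            kron_form k I f n (\<lambda>l. if l \<in> ?L (fst (h t)) (snd (h t)) then u else v)"
          by (rule multiform_cong) (simp add: z_def)
        also have "\<dots> = c (card (?L (fst (h t)) (snd (h t))))"
          unfolding c_def
          by (rule multiform_initial_segment[OF symmetric_kronecker_power[OF sym]]) auto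
        finally show ?thesis by (simp add: split_beta)
      qed
      then have "kron_form k I f (M * n) (\<lambda>l. kron_power_vec n M (z (\<beta> l) (s l))) =
          (\<Prod>t<M. case h t of (S, S') \<Rightarrow> c (card (?L S S')))"
        by (simp add: kron_form_power)
      also have "\<dots> = (\<Prod>(S, S')\<in>X \<times> X. c (card (?L S S')))"
        by (rule prod.reindex_bij_betw[OF h])
      also have "\<dots> = (if const \<and> s ` {..<k} = {..<k} then c p ^ M else 0)"
        unfolding M_def const_def using s zero by (intro prod_incidence[OF p _ X_def]) (auto simp: c_def)
      finally show ?thesis .
    qed
    have "kron_form k I f (M * n) (\<lambda>l. b (\<beta> l)) =
        (\<Sum>s\<in>?E. kron_form k I f (M * n) (\<lambda>l J. \<rho> * kron_power_vec n M (z (\<beta> l) (s l)) J))"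
      unfolding b_def by (rule multiform_sum) simp
    also have "\<dots> = (\<Sum>s\<in>?E. \<rho> ^ k *
        (if const \<and> s ` {..<k} = {..<k} then c p ^ M else 0))"
      by (rule sum.cong[OF refl], subst multiform_scale) (simp only: eval prod_constant card_lessThan)
    also have "\<dots> = (\<Sum>s\<in>?E. if s ` {..<k} = {..<k} then
        (if const then \<rho> ^ k * c p ^ M else 0) else 0)"
      by (rule sum.cong) auto
    also have "\<dots> = (\<Sum>s\<in>{s \<in> ?E. s ` {..<k} = {..<k}}.
        if const then \<rho> ^ k * c p ^ M else 0)"
      by (rule sum.inter_filter[symmetric]) (simp add: finite_PiE)
    also have "\<dots> = of_nat (fact k) * (if const then \<rho> ^ k * c p ^ M else 0)"
      by (simp add: card_surj_PiE)
    also have "\<dots> = (if const then 1 else 0)"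
      using \<open>of_nat (fact k) * c p ^ M \<noteq> 0\<close> by (simp add: \<rho> field_simps)
    finally show ?thesis
      unfolding const_def .
  qed
  then show ?thesis
    unfolding unit_restriction_def by blast
qed

text \<open>Two labels of a unit restriction yield mixed vectors, these yield a symmetric unit
  tensor of size 2 in some power, and k copies of the latter are labelled by the subsets of
  \<open>{..<k}\<close>.\<close>

lemma exists_symmetric_unit_restriction_Pow:
  fixes f :: "(nat \<Rightarrow> 'i) \<Rightarrow> 'a::alg_closed_field"
  assumes "symmetric_tensor k I f" "k \<ge> 2" "of_nat (fact k) \<noteq> (0::'a)" "finite I"
    and "subrank k (multi_indices n I) (kronecker_power k I f n) \<ge> 2"
  shows "\<exists>m B. unit_restriction k (multi_indices m I) (kronecker_power k I f m) (Pow {..<k}) (\<lambda>_. B)"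
proof -
  obtain A where A: "unit_restriction k (multi_indices n I) (kronecker_power k I f n)
      {..<subrank k (multi_indices n I) (kronecker_power k I f n)} A"
    using subrank_attained assms(2,4) finite_multi_indices by blast
  have "unit_restriction k (multi_indices n I) (kronecker_power k I f n) (UNIV :: bool set)
      (\<lambda>l s. A l (if s then 0 else 1))"
    using assms(5) by (intro unit_restriction_reindex[OF A]) (auto intro!: inj_onI split: if_splits)
  then obtain u v p where "0 < p" "p < k"
      "\<forall>j<p. kron_form k I f n (\<lambda>l. if l < j then u else v) = 0"
      "kron_form k I f n (\<lambda>l. if l < p then u else v) \<noteq> 0"
    using unit_restriction_exists_mixed[OF symmetric_kronecker_power[OF assms(1)] assms(2,3)]
    by blast
  then obtain M b where "unit_restriction k (multi_indices (M * n) I)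
      (kronecker_power k I f (M * n)) (UNIV :: bool set) (\<lambda>_. b)"
    using mixed_imp_unit_restriction_power[OF assms(1,3)] by blast
  from unit_restriction_power_Pow[OF this, of k] show ?thesis
    by blast
qed

text \<open>The switch has the label set \<open>Pow {..<k}\<close> for every n, so the power of
  \<open>f\<close> that supplies it gives one shift m for all n.\<close>

lemma subrank_le_symmetric_subrank_shift:
  fixes f :: "(nat \<Rightarrow> 'i) \<Rightarrow> 'a::alg_closed_field"
  assumes "symmetric_tensor k I f" "k \<ge> 2" "of_nat (fact k) \<noteq> (0::'a)" "finite I"
    and "subrank k (multi_indices n\<^sub>0 I) (kronecker_power k I f n\<^sub>0) \<ge> 2"
  shows "\<exists>m. \<forall>n. subrank k (multi_indices n I) (kronecker_power k I f n) \<le>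
    symmetric_subrank k (multi_indices (n + m) I) (kronecker_power k I f (n + m))"
proof -
  obtain m B where B: "unit_restriction k (multi_indices m I) (kronecker_power k I f m) (Pow {..<k}) (\<lambda>_. B)"
    using exists_symmetric_unit_restriction_Pow[OF assms] by blast
  have "subrank k (multi_indices n I) (kronecker_power k I f n) \<le>
    symmetric_subrank k (multi_indices (n + m) I) (kronecker_power k I f (n + m))" for n
  proof -
    let ?r = "subrank k (multi_indices n I) (kronecker_power k I f n)"
    obtain A where "unit_restriction k (multi_indices n I) (kronecker_power k I f n) {..<?r} A"
      using subrank_attained assms(2,4) finite_multi_indices by blast
    then obtain C where "unit_restriction k (multi_indices (n + m) I)
        (kronecker_power k I f (n + m)) {..<?r} (\<lambda>_. C)"
      using symmetric_unit_restriction_kron[OF assms(1) _ assms(3) _ B] assms(2) by fastforce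
    from le_symmetric_subrank[OF assms(2) _ _ this] show ?thesis
      using assms(4) by simp
  qed
  then show ?thesis by blast
qed

section \<open>Supermultiplicativity and positivity\<close>

lemma subrank_kron_mult_le:
  assumes "k \<ge> 2" "finite I"
  shows "subrank k (multi_indices n I) (kronecker_power k I f n) *
      subrank k (multi_indices m I) (kronecker_power k I f m) \<le>
    subrank k (multi_indices (n + m) I) (kronecker_power k I f (n + m))"
proof -
  obtain A B where "unit_restriction k (multi_indices n I) (kronecker_power k I f n)
      {..<subrank k (multi_indices n I) (kronecker_power k I f n)} A"
    "unit_restriction k (multi_indices m I) (kronecker_power k I f m)
      {..<subrank k (multi_indices m I) (kronecker_power k I f m)} B"
    using subrank_attained[OF assms(1)] finite_multi_indices[OF assms(2)] by metis
  from le_subrank[OF assms(1) _ _ unit_restriction_kron[OF this]] show ?thesis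
    using assms(2) by (simp add: card_cartesian_product)
qed

lemma multiform_nonzero:
  fixes f :: "(nat \<Rightarrow> 'i) \<Rightarrow> 'a::field"
  assumes "finite I" "j \<in> multi_indices k I" "f j \<noteq> 0"
  shows "\<exists>x. multiform k I f x \<noteq> 0"
proof -
  have "(\<Prod>l<k. if j' l = j l then 1 else 0) = (if j' = j then 1 else 0 :: 'a)"
    if "j' \<in> multi_indices k I" for j'
  proof (cases "j' = j")
    case False
    have "\<exists>l<k. j' l \<noteq> j l"
    proof (rule ccontr)
      assume "\<not> ?thesis"
      then have "j' = j"
        using that assms(2) unfolding multi_indices_def by (intro PiE_ext) auto
      then show False
        using False by contradiction
    qed
    then obtain l where "l < k" "j' l \<noteq> j l" by blast
    then have "\<exists>l\<in>{..<k}. (if j' l = j l then 1 else 0 :: 'a) = 0"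
      by (intro bexI[of _ l]) simp_all
    then have "(\<Prod>l<k. if j' l = j l then 1 else 0 :: 'a) = 0"
      by (intro prod_zero) simp_all
    then show ?thesis
      using False by simp
  qed simp
  \<comment> \<open>At the unit vectors selected by \<open>j\<close> the form returns the entry
    \<open>f j\<close>.\<close>
  then have "multiform k I f (\<lambda>l i. if i = j l then 1 else 0) =
      (\<Sum>j'\<in>multi_indices k I. if j' = j then f j else 0)"
    unfolding multiform_def by (intro sum.cong refl) simp
  also have "\<dots> = f j"
    using assms(1,2) by simp
  finally show ?thesis
    using assms(3) by metis
qed

text \<open>By polarization a nonzero symmetric tensor has a nonzero value on some diagonal argument
  \<open>u\<close>, and a k-th root rescales \<open>u\<close> so that the value becomes 1. The
  single label is the unit element.\<close>

lemma symmetric_subrank_ge_1: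
  fixes f :: "(nat \<Rightarrow> 'i) \<Rightarrow> 'a::alg_closed_field"
  assumes "symmetric_tensor k I f" "k \<ge> 2" "of_nat (fact k) \<noteq> (0::'a)" "finite I"
    and "j \<in> multi_indices k I" "f j \<noteq> 0"
  shows "symmetric_subrank k I f \<ge> 1"
proof -
  obtain x where "multiform k I f x \<noteq> 0"
    using multiform_nonzero[of I j k f, OF assms(4-6)] by blast
  then have "(\<Sum>S\<in>Pow {..<k}. (-1) ^ card ({..<k} - S) * multiform k I f (\<lambda>_ i. \<Sum>s\<in>S. x s i)) \<noteq> 0"
    using polarization_symmetric[OF assms(1), of x] assms(3) by simp
  then have "\<exists>S. multiform k I f (\<lambda>_ i. \<Sum>s\<in>S. x s i) \<noteq> 0"
    by (rule contrapos_np) (simp add: sum.neutral)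
  then obtain u where u: "multiform k I f (\<lambda>_. u) \<noteq> 0" by blast
  obtain \<rho> where \<rho>: "\<rho> ^ k = inverse (multiform k I f (\<lambda>_. u))"
    using nth_root_exists[of k] assms(2) by (metis gr0I not_numeral_le_zero)
  have "multiform k I f (\<lambda>_ i. \<rho> * u i) = 1"
    using u by (subst multiform_scale) (simp add: \<rho>)
  then have "unit_restriction k I f {()} (\<lambda>_ _ i. \<rho> * u i)"
    by (simp add: unit_restriction_def)
  from le_symmetric_subrank[OF assms(2,4) _ this] show ?thesis
    by simp
qed

lemma kronecker_power_nonzero:
  assumes "j \<in> multi_indices k I" "f j \<noteq> 0"
  shows "\<exists>J\<in>multi_indices k (multi_indices n I). kronecker_power k I f n J \<noteq> 0"
proof -
  \<comment> \<open>Every copy of \<open>f\<close> reads the same multi-index \<open>j\<close>, so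
    the entry at \<open>J\<close> is the n-th power of \<open>f j\<close>.\<close>
  define J where "J = (\<lambda>l\<in>{..<k}. \<lambda>m\<in>{..<n}. j l)"
  have J: "J \<in> multi_indices k (multi_indices n I)"
    using assms(1) unfolding J_def multi_indices_def by (auto simp: Pi_iff PiE_iff)
  have "(\<lambda>l\<in>{..<k}. J l m) = j" if "m < n" for m
    using that assms(1)
    by (auto simp: J_def multi_indices_def PiE_iff extensional_def restrict_def fun_eq_iff)
  then have "kronecker_power k I f n J \<noteq> 0"
    using J assms(2) by (simp add: kronecker_power_def)
  then show ?thesis
    using J by blast
qed

section \<open>Asymptotics\<close>

lemma superadditive_mult:
  fixes a :: "nat \<Rightarrow> real"
  assumes "\<And>m n. a m + a n \<le> a (m + n)" "a 0 \<ge> 0"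
  shows "real q * a m \<le> a (q * m)"
proof (induction q)
  case (Suc q)
  then show ?case
    using assms(1)[of m "q * m"] by (simp add: algebra_simps)
qed (use assms(2) in simp)

text \<open>Fekete's lemma. Choose m with \<open>a m / m\<close> close to the supremum and divide n
  by m: superadditivity handles the multiples of m, nonnegativity lets the remainder be dropped, and
  the loss is at most \<open>a m / n\<close>.\<close>

lemma fekete_superadditive:
  fixes a :: "nat \<Rightarrow> real"
  assumes super: "\<And>m n. a m + a n \<le> a (m + n)" and nonneg: "\<And>n. a n \<ge> 0"
    and bound: "\<And>n. n > 0 \<Longrightarrow> a n \<le> real n * K"
  shows "(\<lambda>n. a n / real n) \<longlonglongrightarrow> (SUP n\<in>{0<..}. a n / real n)"
    (is "_ \<longlonglongrightarrow> ?L")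
proof -
  have bdd: "bdd_above ((\<lambda>n. a n / real n) ` {0<..})"
    using bound by (intro bdd_aboveI2[of _ _ K]) (simp add: field_simps)
  have upper: "a n / real n \<le> ?L" if "n > 0" for n
    using that bdd by (intro cSUP_upper) auto
  show ?thesis
  proof (rule LIMSEQ_I)
    fix e :: real assume "e > 0"
    then have "?L - e / 2 < ?L" by simp
    then obtain m where m: "m > 0" "?L - e / 2 < a m / real m"
      using less_cSUP_iff[OF _ bdd] by auto
    have lower: "a n / real n \<ge> a m / real m - a m / real n" if "n > 0" for n
    proof -
      have "n \<le> n div m * m + m"
        using mod_less_divisor[OF m(1), of n] div_mult_mod_eq[of n m] by linarith
      then have "real n \<le> real (n div m * m + m)"
        by (simp only: of_nat_le_iff)
      then have "real n - real m \<le> real (n div m) * real m"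
        by simp
      then have "(real n - real m) * a m \<le> (real (n div m) * real m) * a m"
        using nonneg by (rule mult_right_mono)
      also have "\<dots> = real m * (real (n div m) * a m)"
        by simp
      also have "\<dots> \<le> real m * a n"
      proof (rule mult_left_mono)
        have "real (n div m) * a m \<le> a (n div m * m)"
          using superadditive_mult[OF super nonneg] .
        also have "\<dots> \<le> a (n div m * m + n mod m)"
          using super[of "n div m * m" "n mod m"] nonneg[of "n mod m"] by linarith
        finally show "real (n div m) * a m \<le> a n" by simp
      qed simp
      finally have le: "(real n - real m) * a m \<le> real m * a n" .
      have "a m / real m - a m / real n = (real n - real m) * a m / (real m * real n)"
        using that m(1) by (simp add: field_simps)
      also have "\<dots> \<le> real m * a n / (real m * real n)"
        using le by (rule divide_right_mono) simp
      also have "\<dots> = a n / real n"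
        using m(1) by simp
      finally show ?thesis .
    qed
    have "(\<lambda>n. a m / real n) \<longlonglongrightarrow> 0"
      by real_asymp
    then have "eventually (\<lambda>n. a m / real n < e / 2) sequentially"
      using \<open>e > 0\<close> by (intro order_tendstoD) auto
    then have "eventually (\<lambda>n. a m / real n < e / 2 \<and> n > 0) sequentially"
      using eventually_gt_at_top by (rule eventually_conj)
    then obtain n0 where n0: "\<And>n. n \<ge> n0 \<Longrightarrow> a m / real n < e / 2 \<and> n > 0"
      unfolding eventually_sequentially by blast
    have "norm (a n / real n - ?L) < e" if "n \<ge> n0" for n
      using n0[OF that] lower[of n] upper[of n] m(2) \<open>e > 0\<close> unfolding real_norm_def by linarith
    then show "\<exists>n0. \<forall>n\<ge>n0. norm (a n / real n - ?L) < e" by blast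
  qed
qed

lemma root_eq_exp_ln:
  assumes "n > 0" "x > 0"
  shows "root n x = exp (ln x / real n)"
  using assms by (simp add: root_powr_inverse powr_def divide_inverse mult.commute)

lemma supermultiplicative_ln_tendsto:
  fixes q :: "nat \<Rightarrow> nat"
  assumes mult: "\<And>m n. q m * q n \<le> q (m + n)" and pos: "\<And>n. q n \<ge> 1"
    and bound: "\<And>n. q n \<le> d ^ n"
  shows "\<exists>L. (\<lambda>n. ln (real (q n)) / real n) \<longlonglongrightarrow> L"
proof -
  have d: "d \<ge> 1"
    using bound[of 1] pos[of 1] by simp
  have "real (q n) \<le> real d ^ n" for n
    using bound[of n] by (metis of_nat_le_iff of_nat_power)
  moreover have q: "real (q n) > 0" for n
    using pos[of n] by simp
  ultimately have "ln (real (q n)) \<le> real n * ln (real d)" for n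
    using d by (subst ln_realpow[symmetric]) (simp_all add: ln_le_cancel_iff)
  moreover have "ln (real (q m)) + ln (real (q n)) \<le> ln (real (q (m + n)))" for m n
  proof -
    have "ln (real (q m)) + ln (real (q n)) = ln (real (q m * q n))"
      using q by (simp add: ln_mult_pos)
    also have "\<dots> \<le> ln (real (q (m + n)))"
    proof (rule iffD2[OF ln_le_cancel_iff])
      show "0 < real (q m * q n)" "0 < real (q (m + n))"
        using q[of m] q[of n] q[of "m + n"] by simp_all
      show "real (q m * q n) \<le> real (q (m + n))"
        using mult by (simp only: of_nat_le_iff)
    qed
    finally show ?thesis .
  qed
  moreover have "ln (real (q n)) \<ge> 0" for n
    using pos[of n] by simp
  ultimately show ?thesis
    using fekete_superadditive[of "\<lambda>n. ln (real (q n))" "ln (real d)"] by blast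
qed

text \<open>At n + m the logarithm of \<open>s\<close> lies between those of \<open>q n\<close> and
  \<open>q (n + m)\<close>. After division by n + m both bounds tend to L, because n / (n + m) tends
  to 1.\<close>

lemma root_tendsto_sandwich:
  fixes q s :: "nat \<Rightarrow> nat"
  assumes "(\<lambda>n. ln (real (q n)) / real n) \<longlonglongrightarrow> L" and pos: "\<And>n. q n \<ge> 1"
    and le: "\<And>n. s n \<le> q n" and shift: "\<And>n. q n \<le> s (n + m)"
  shows "(\<lambda>n. root n (real (q n))) \<longlonglongrightarrow> exp L" "(\<lambda>n. root n (real (s n))) \<longlonglongrightarrow> exp L"
proof -
  \<comment> \<open>Positivity is required only eventually, since for \<open>s\<close> it is
    guaranteed only from the index m on.\<close>
  have root: "(\<lambda>n. root n (real (t n))) \<longlonglongrightarrow> exp L"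
    if "(\<lambda>n. ln (real (t n)) / real n) \<longlonglongrightarrow> L" "eventually (\<lambda>n. t n \<ge> 1) sequentially"
    for t :: "nat \<Rightarrow> nat"
  proof (rule Lim_transform_eventually)
    show "(\<lambda>n. exp (ln (real (t n)) / real n)) \<longlonglongrightarrow> exp L"
      using that(1) by (rule tendsto_exp)
    show "eventually (\<lambda>n. exp (ln (real (t n)) / real n) = root n (real (t n))) sequentially"
      using that(2) eventually_gt_at_top[of 0] by eventually_elim (simp add: root_eq_exp_ln)
  qed
  show "(\<lambda>n. root n (real (q n))) \<longlonglongrightarrow> exp L"
    using assms(1) pos by (intro root) auto
  have s_pos: "s (n + m) \<ge> 1" for n
    using pos[of n] shift[of n] by linarith
  have "(\<lambda>n. ln (real (s (n + m))) / real (n + m)) \<longlonglongrightarrow> L"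
  proof (rule tendsto_sandwich)
    have "(\<lambda>n. ln (real (q n)) / real n * (real n / real (n + m))) \<longlonglongrightarrow> L * 1"
      by (intro tendsto_mult assms(1)) real_asymp
    then show "(\<lambda>n. ln (real (q n)) / real n * (real n / real (n + m))) \<longlonglongrightarrow> L" by simp
    show "(\<lambda>n. ln (real (q (n + m))) / real (n + m)) \<longlonglongrightarrow> L"
      using assms(1) by (rule LIMSEQ_ignore_initial_segment)
    show "eventually (\<lambda>n. ln (real (q n)) / real n * (real n / real (n + m)) \<le>
        ln (real (s (n + m))) / real (n + m)) sequentially"
      using eventually_gt_at_top[of 0]
    proof eventually_elim
      case (elim n)
      have "ln (real (q n)) \<le> ln (real (s (n + m)))"
        using pos[of n] shift[of n] by simp
      then show ?case
        using elim by (simp add: divide_right_mono)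
    qed
    show "eventually (\<lambda>n. ln (real (s (n + m))) / real (n + m) \<le>
        ln (real (q (n + m))) / real (n + m)) sequentially"
    proof (rule always_eventually, rule allI)
      fix n
      show "ln (real (s (n + m))) / real (n + m) \<le> ln (real (q (n + m))) / real (n + m)"
        using s_pos[of n] le[of "n + m"] by (intro divide_right_mono) auto
    qed
  qed
  then have "(\<lambda>n. ln (real (s n)) / real n) \<longlonglongrightarrow> L"
    by (rule LIMSEQ_offset)
  moreover have "eventually (\<lambda>n. s n \<ge> 1) sequentially"
    using eventually_ge_at_top[of m] by eventually_elim (metis s_pos le_add_diff_inverse2)
  ultimately show "(\<lambda>n. root n (real (s n))) \<longlonglongrightarrow> exp L"
    by (rule root)
qed

section \<open>The characteristic, the zero tensor and the conclusion\<close>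

lemma of_nat_fact_neq_0:
  assumes "CHAR('a::idom) = 0 \<or> CHAR('a) > k"
  shows "of_nat (fact k) \<noteq> (0::'a)"
proof
  assume "of_nat (fact k) = (0::'a)"
  then have dvd: "CHAR('a) dvd fact k"
    by (simp only: of_nat_eq_0_iff_char_dvd)
  then have "CHAR('a) \<noteq> 0"
    by (metis dvd_0_left_iff fact_nonzero)
  \<comment> \<open>A nonzero characteristic is prime, and a prime divides k! only if it is at most
    k.\<close>
  then have "prime (CHAR('a))" "CHAR('a) > k"
    using assms prime_CHAR_semidom[where ?'a = 'a] by auto
  with dvd show False
    by (simp add: prime_dvd_fact_iff)
qed

text \<open>For n > 0 each entry of the power contains an entry of \<open>f\<close> as a factor. The
  power with n = 0 is excluded: its entry is the empty product 1.\<close>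

lemma subrank_kron_zero:
  assumes "k \<ge> 2" "finite I" "\<And>j. j \<in> multi_indices k I \<Longrightarrow> f j = 0" "n > 0"
  shows "subrank k (multi_indices n I) (kronecker_power k I f n) = 0"
proof (rule ccontr)
  assume pos: "subrank k (multi_indices n I) (kronecker_power k I f n) \<noteq> 0"
  have "kronecker_power k I f n J = 0" if J: "J \<in> multi_indices k (multi_indices n I)" for J
  proof -
    have "(\<lambda>l\<in>{..<k}. J l 0) \<in> multi_indices k I"
      using J assms(4) by (auto simp: multi_indices_def PiE_iff)
    then have "\<exists>m\<in>{..<n}. f (\<lambda>l\<in>{..<k}. J l m) = 0"
      using assms(3,4) by (intro bexI[of _ 0]) simp_all
    then show ?thesis
      using J by (simp add: kronecker_power_def)
  qed
  then have zero: "kron_form k I f n x = 0" for x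
    by (simp add: multiform_def)
  obtain A where A: "unit_restriction k (multi_indices n I) (kronecker_power k I f n)
      {..<subrank k (multi_indices n I) (kronecker_power k I f n)} A"
    using subrank_attained[OF assms(1)] finite_multi_indices[OF assms(2)] by metis
  show False
    using unit_restrictionD[OF A, of "\<lambda>_. 0"] pos zero by simp
qed

theorem theorem3p4:
  fixes k d :: nat and f :: "(nat \<Rightarrow> nat) \<Rightarrow> 'a::alg_closed_field"
  assumes "k \<ge> 2"
    and "CHAR('a) = 0 \<or> CHAR('a) \<ge> k + 1"
    and "symmetric_tensor k {..<d} f"
  shows "\<exists>L::real.
     (\<lambda>n. root n (real (subrank k (multi_indices n {..<d}) (kronecker_power k {..<d} f n))))
       \<longlonglongrightarrow> L \<and>
     limsup (\<lambda>n. ereal (root n (real (symmetric_subrank k (multi_indices n {..<d})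
       (kronecker_power k {..<d} f n))))) = ereal L"
proof -
  define q where "q n = subrank k (multi_indices n {..<d}) (kronecker_power k {..<d} f n)" for n
  define s where "s n = symmetric_subrank k (multi_indices n {..<d}) (kronecker_power k {..<d} f n)" for n
  have fact: "of_nat (fact k) \<noteq> (0::'a)"
    using assms(2) by (intro of_nat_fact_neq_0) auto
  have s_le_q: "s n \<le> q n" for n
    unfolding s_def q_def by (intro symmetric_subrank_le_subrank assms(1)) simp
  \<comment> \<open>The symmetric subranks are shown to converge too, which makes the limsup a
    limit.\<close>
  have "\<exists>L. (\<lambda>n. root n (real (q n))) \<longlonglongrightarrow> L \<and> (\<lambda>n. root n (real (s n))) \<longlonglongrightarrow> L"
  proof (cases "\<exists>j\<in>multi_indices k {..<d}. f j \<noteq> 0")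
    case False
    then have q_0: "q n = 0" if "n > 0" for n
      unfolding q_def using assms(1) that by (intro subrank_kron_zero) auto
    then have s_0: "s n = 0" if "n > 0" for n
      using that s_le_q[of n] by simp
    have "eventually (\<lambda>n. root n (real (q n)) = 0) sequentially"
      using eventually_gt_at_top[of 0] by eventually_elim (simp add: q_0)
    moreover have "eventually (\<lambda>n. root n (real (s n)) = 0) sequentially"
      using eventually_gt_at_top[of 0] by eventually_elim (simp add: s_0)
    ultimately show ?thesis
      by (intro exI[of _ 0] conjI tendsto_eventually)
  next
    case True
    then obtain j where j: "j \<in> multi_indices k {..<d}" "f j \<noteq> 0" by blast
    have s_pos: "s n \<ge> 1" for n
    proof -
      obtain J where J: "J \<in> multi_indices k (multi_indices n {..<d})" "kronecker_power k {..<d} f n J \<noteq> 0"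
        using kronecker_power_nonzero[of j k "{..<d}" f n, OF j] by blast
      show ?thesis
        unfolding s_def
        by (rule symmetric_subrank_ge_1[where j = J and f = "kronecker_power k {..<d} f n",
              OF symmetric_kronecker_power[OF assms(3)] assms(1) fact _ J]) simp
    qed
    have q_pos: "q n \<ge> 1" for n
      using s_pos[of n] s_le_q[of n] by linarith
    have "q n \<le> d ^ n" for n
      unfolding q_def using subrank_le_card[OF assms(1), of "multi_indices n {..<d}"]
      by (simp add: multi_indices_def card_PiE finite_PiE)
    moreover have "q m * q n \<le> q (m + n)" for m n
      unfolding q_def by (intro subrank_kron_mult_le assms(1)) simp
    ultimately obtain L where "(\<lambda>n. ln (real (q n)) / real n) \<longlonglongrightarrow> L"
      using supermultiplicative_ln_tendsto[of q d] q_pos by blast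
    moreover obtain m where m: "\<And>n. q n \<le> s (n + m)"
    proof (cases "\<exists>n. q n \<ge> 2")
      case True
      then show ?thesis
        using subrank_le_symmetric_subrank_shift[OF assms(3,1) fact] that unfolding q_def s_def by blast
    next
      \<comment> \<open>Here every \<open>q n\<close> is at most 1 while every \<open>s n\<close> is
        at least 1, so the shift 0 works.\<close>
      case False
      have "q n \<le> s (n + 0)" for n
      proof -
        have "\<not> q n \<ge> 2" using False by blast
        then show ?thesis using s_pos[of n] by simp
      qed
      then show ?thesis
        by (rule that)
    qed
    ultimately show ?thesis
      using root_tendsto_sandwich[where q = q and s = s and m = m, OF _ q_pos s_le_q m] by blast
  qed
  then obtain L where "(\<lambda>n. root n (real (q n))) \<longlonglongrightarrow> L" "(\<lambda>n. root n (real (s n))) \<longlonglongrightarrow> L"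
    by blast
  moreover from this(2) have "limsup (\<lambda>n. ereal (root n (real (s n)))) = ereal L"
    by (intro lim_imp_Limsup tendsto_ereal) simp_all
  ultimately show ?thesis
    unfolding q_def s_def by blast
qed

end
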